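(* Let $\mathcal K_{\boldsymbol s}$ be a singular kernel given by the series expansion $$\mathcal K_{\boldsymbol s}=\sum_{\ell=1,2,\dots} R^{-2(\ell+m_1)+1}\,P^{[\ell]}_{3\ell+m_2},$$ with regularity $m:=\zeta(\mathcal K_{\boldsymbol s})=-2m_1+m_2+2<0$, and let $\mathcal K_{\boldsymbol s,n}$ be its truncation after the $n$-th term, $$\mathcal K_{\boldsymbol s,n}=\sum_{\ell=1}^{n} R^{-2(\ell+m_1)+1}\,P^{[\ell]}_{3\ell+m_2}.$$ Let $\rho=\mathcal K_{\boldsymbol s}-\mathcal K_{\boldsymbol s,n}$ be the regularized kernel with $m+n\ge 1$. Then $\rho$ is a $C^{m+n-1}$ smooth function at $\boldsymbol z=\boldsymbol 0$ and $D^\alpha\rho(\boldsymbol 0)=0$ for $0\le|\alpha|\le m+n-1$.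
   Context: The kernel $\mathcal K_{\boldsymbol s}=\mathcal K_{\boldsymbol s}(\boldsymbol z)$ is expressed about a fixed source point $\boldsymbol s$ in local intrinsic coordinates $\boldsymbol z=(z_1,z_2)\in\mathbb R^2$, and the source point corresponds to $\boldsymbol z=\boldsymbol 0$. The numbers $m_1\ge 0$ and $m_2\ge -3$ are integers, and $n$ is a positive integer. The function $R$ is $R(\boldsymbol z)=\sqrt{a z_1^2+b z_1z_2+c z_2^2}$ with real constants $a,c>0$ and $b$ satisfying $4ac-b^2>0$. Each $P^{[\ell]}_{3\ell+m_2}$ is a bivariate homogeneous polynomial of degree $3\ell+m_2$. The parameter $\zeta$ is defined by $\zeta(R^p z_1^q z_2^r):=p+q+r$, and for a sum of such terms (written in irreducible form) it is the minimum of the values of $\zeta$ over the terms. The kernel $\mathcal K_{\boldsymbol s}$ is assumed to be sufficiently smooth on the punctured disk $D_\varepsilon:=\{\boldsymbol z: 0<\|\boldsymbol z\|_2\le\varepsilon\}$ for some fixed $\varepsilon>0$. For a multi-index $\alpha=(\alpha_1,\alpha_2)\in\mathbb N_0^2$, $|\alpha|=\alpha_1+\alpha_2$ and $D^\alpha=\partial^{|\alpha|}/(\partial z_1^{\alpha_1}\partial z_2^{\alpha_2})$. The value of $\rho$ at $\boldsymbol z=\boldsymbol 0$ is understood as its continuous extension. *)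

theory Defs
  imports "HOL-Analysis.Analysis" "HOL-Computational_Algebra.Polynomial"
begin

text \<open>
  Points of the parameter plane are \<^typ>\<open>real^2\<close>, whose norm is the Euclidean norm. Kernels take
  values in an arbitrary complete real normed field, which covers real and complex kernels alike.
\<close>

definition partial_deriv :: "2 \<Rightarrow> (real^2 \<Rightarrow> 'a::real_normed_vector) \<Rightarrow> real^2 \<Rightarrow> 'a" where
  "partial_deriv i f z = vector_derivative (\<lambda>t. f (z + t *\<^sub>R axis i 1)) (at 0)"

definition has_partial_deriv :: "2 \<Rightarrow> (real^2 \<Rightarrow> 'a::real_normed_vector) \<Rightarrow> real^2 \<Rightarrow> bool" where
  "has_partial_deriv i f z \<longleftrightarrow> (\<lambda>t. f (z + t *\<^sub>R axis i 1)) differentiable (at 0)"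

definition multi_deriv :: "nat \<times> nat \<Rightarrow> (real^2 \<Rightarrow> 'a::real_normed_vector) \<Rightarrow> real^2 \<Rightarrow> 'a" where
  "multi_deriv \<alpha> f = (partial_deriv 1 ^^ fst \<alpha>) ((partial_deriv 2 ^^ snd \<alpha>) f)"

text \<open>
  Intended for open \<open>U\<close> only: all iterated partial derivatives of order at most \<open>k\<close>, taken in any
  order, exist and are continuous on \<open>U\<close>.
\<close>

primrec Ck_on :: "nat \<Rightarrow> (real^2) set \<Rightarrow> (real^2 \<Rightarrow> 'a::real_normed_vector) \<Rightarrow> bool" where
  "Ck_on 0 U f \<longleftrightarrow> continuous_on U f"
| "Ck_on (Suc k) U f \<longleftrightarrow> continuous_on U f \<and>
     (\<forall>i. (\<forall>z\<in>U. has_partial_deriv i f z) \<and> Ck_on k U (partial_deriv i f))"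

definition Ck_at :: "nat \<Rightarrow> (real^2 \<Rightarrow> 'a::real_normed_vector) \<Rightarrow> real^2 \<Rightarrow> bool" where
  "Ck_at k f z \<longleftrightarrow> (\<exists>U. open U \<and> z \<in> U \<and> Ck_on k U f)"

definition punctured_disk :: "real \<Rightarrow> (real^2) set" where
  "punctured_disk \<epsilon> = {z. 0 < norm z \<and> norm z \<le> \<epsilon>}"

text \<open>
  If the limit at the origin does not exist, the value at the origin is arbitrary and the resulting
  function is not continuous there; so \<^term>\<open>Ck_at k (extend_at_0 f) 0\<close> includes the existence of
  the continuous extension.
\<close>

definition extend_at_0 :: "(real^2 \<Rightarrow> 'a::real_normed_vector) \<Rightarrow> real^2 \<Rightarrow> 'a" where
  "extend_at_0 f = f(0 := Lim (at 0) f)"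

text \<open>
  A bivariate polynomial is an element of \<^typ>\<open>'a poly poly\<close>; the coefficient of
  \<open>z\<^sub>1 ^ q * z\<^sub>2 ^ r\<close> is \<open>coeff (coeff p r) q\<close>, i.e. the outer variable is \<open>z\<^sub>2\<close>.
\<close>

definition eval2 :: "'a::comm_ring_1 poly poly \<Rightarrow> 'a \<Rightarrow> 'a \<Rightarrow> 'a" where
  "eval2 p x y = poly (poly p [:y:]) x"

text \<open>The zero polynomial counts as homogeneous of every degree.\<close>

definition homogeneous2 :: "int \<Rightarrow> 'a::zero poly poly \<Rightarrow> bool" where
  "homogeneous2 d p \<longleftrightarrow> (\<forall>q r. coeff (coeff p r) q \<noteq> 0 \<longrightarrow> int q + int r = d)"

definition R :: "real \<Rightarrow> real \<Rightarrow> real \<Rightarrow> real^2 \<Rightarrow> real" where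
  "R a b c z = sqrt (a * (z$1)^2 + b * (z$1) * (z$2) + c * (z$2)^2)"

definition R_exponent :: "int \<Rightarrow> nat \<Rightarrow> int" where
  "R_exponent m\<^sub>1 l = -2 * (int l + m\<^sub>1) + 1"

definition kernel_term :: "real \<Rightarrow> real \<Rightarrow> real \<Rightarrow> int \<Rightarrow> (nat \<Rightarrow> 'a::real_normed_field poly poly)
    \<Rightarrow> nat \<Rightarrow> real^2 \<Rightarrow> 'a" where
  "kernel_term a b c m\<^sub>1 P l z =
     of_real (R a b c z powi R_exponent m\<^sub>1 l) * eval2 (P l) (of_real (z$1)) (of_real (z$2))"

definition kernel_trunc :: "real \<Rightarrow> real \<Rightarrow> real \<Rightarrow> int \<Rightarrow> (nat \<Rightarrow> 'a::real_normed_field poly poly)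
    \<Rightarrow> nat \<Rightarrow> real^2 \<Rightarrow> 'a" where
  "kernel_trunc a b c m\<^sub>1 P n z = (\<Sum>l=1..n. kernel_term a b c m\<^sub>1 P l z)"

text \<open>
  The minimum of \<open>p + q + r\<close> over the terms \<open>R ^ p * z\<^sub>1 ^ q * z\<^sub>2 ^ r\<close> that occur in the expansion.
  When \<open>P l\<close> is homogeneous of degree \<open>3 * l + m\<^sub>2\<close>, the sum \<open>p + q + r\<close> determines \<open>l\<close> and hence
  the power of \<open>R\<close>, so no two listed terms can cancel; rewriting \<open>R\<^sup>2\<close> as a quadratic form does not
  change \<open>p + q + r\<close>. Hence the terms with nonzero coefficient are those of the irreducible form.
\<close>

definition kernel_zeta :: "int \<Rightarrow> (nat \<Rightarrow> 'a::zero poly poly) \<Rightarrow> int" where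
  "kernel_zeta m\<^sub>1 P = (LEAST v. \<exists>l q r. 1 \<le> l \<and> coeff (coeff (P l) r) q \<noteq> 0 \<and>
     v = R_exponent m\<^sub>1 l + int q + int r)"

end

theory Submission
  imports Defs
begin

text \<open>
  The \<open>l\<close>-th term of the expansion is homogeneous of degree \<open>m + l - 1\<close>, where powers of \<open>R\<close> count with
  their exponents, so each derivative of order \<open>j\<close> is \<open>O(|z| ^ (m + l - 1 - j))\<close>. The remainder \<open>\<rho>\<close>
  only contains terms with \<open>l > n\<close>. If these bounds can be summed over \<open>l\<close>, the derivatives of \<open>\<rho>\<close> of
  order \<open>j \<le> m + n - 1\<close> are \<open>O(|z| ^ (m + n - j))\<close> with a positive exponent, so they extend continuously
  by \<open>0\<close>; and when \<open>j < m + n - 1\<close> the exponent is at least \<open>2\<close>, so the extended derivative is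
  differentiable at the origin with derivative \<open>0\<close>.

  Hence everything rests on a bound \<open>M * C ^ l\<close> for the implied constants. The expansion is only known
  to converge pointwise, which gives no uniformity in \<open>z\<close> by itself. The uniformity comes from three
  facts. First, the terms are bounded in \<open>l\<close> at each point of a segment \<open>z\<^sub>1 = \<epsilon> / 2\<close>, so by
  Baire's theorem they are uniformly bounded on a subsegment (\<open>bounded_on_subinterval\<close>). Second, a
  polynomial of degree at most \<open>d\<close> that is bounded by \<open>M\<close> on an interval has coefficients bounded by
  \<open>M * K ^ d\<close> (\<open>coeff_bound_of_bounded_on_interval\<close>, by Lagrange interpolation). As the
  degrees grow linearly in \<open>l\<close>, the coefficients of the \<open>l\<close>-th polynomial grow at most geometrically.
  Third, the class of functions with bounds \<open>B * |z| ^ (s - j)\<close> on the derivatives of order \<open>j \<le> k\<close> is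
  closed under products at the cost of a factor \<open>2 ^ k\<close> (\<open>derivs_bounded_mult\<close>). A monomial
  \<open>R ^ (-e) * z\<^sub>1 ^ q * z\<^sub>2 ^ r\<close> has linearly many factors in \<open>l\<close>, so it suffices to bound \<open>1 / R\<close> and the
  coordinates, and no formula for higher derivatives is needed. On a disk with \<open>C * \<delta> \<le> 1 / 2\<close> the
  resulting geometric series may be differentiated termwise (\<open>derivs_bounded_series\<close>).
\<close>

section \<open>Bounds on derivatives that scale like a power of the distance to the origin\<close>

definition has_partial :: "2 \<Rightarrow> (real^2 \<Rightarrow> 'a::real_normed_vector) \<Rightarrow> 'a \<Rightarrow> real^2 \<Rightarrow> bool" where
  "has_partial i f D z \<longleftrightarrow> ((\<lambda>t. f (z + t *\<^sub>R axis i 1)) has_vector_derivative D) (at 0)"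

lemma has_partial_imp:
  assumes "has_partial i f D z"
  shows "has_partial_deriv i f z" "partial_deriv i f z = D"
  using assms unfolding has_partial_def has_partial_deriv_def partial_deriv_def
  by (auto intro: differentiableI_vector vector_derivative_at)

text \<open>
  Partial derivatives are local, so formulas valid near a point other than the origin survive when the
  value at the origin is changed.
\<close>

lemma has_partial_transform:
  assumes D: "has_partial i f D z" and "open U" "z \<in> U" "\<And>w. w \<in> U \<Longrightarrow> f w = g w"
  shows "has_partial i g D z"
proof -
  define V where "V = (\<lambda>t. z + t *\<^sub>R axis i 1) -` U"
  have "open V"
    unfolding V_def by (intro open_vimage assms continuous_intros)
  moreover have "0 \<in> V" using assms by (simp add: V_def)
  ultimately show ?thesis
    using D unfolding has_partial_def
    by (elim has_vector_derivative_transform_within_open) (auto simp: V_def assms)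
qed

lemma has_partial_const: "has_partial i (\<lambda>z. c) 0 z"
  by (simp add: has_partial_def)

lemma has_partial_add:
  assumes "has_partial i f D z" "has_partial i g E z"
  shows "has_partial i (\<lambda>z. f z + g z) (D + E) z"
  using assms unfolding has_partial_def by (rule has_vector_derivative_add)

lemma has_partial_mult:
  fixes f g :: "real^2 \<Rightarrow> 'a::real_normed_algebra"
  assumes "has_partial i f D z" "has_partial i g E z"
  shows "has_partial i (\<lambda>z. f z * g z) (f z * E + D * g z) z"
  using has_vector_derivative_mult[OF assms[unfolded has_partial_def]] by (simp add: has_partial_def)

text \<open>
  The behaviour of a function that is smooth off the origin and homogeneous of degree \<open>s\<close>: a derivative
  of order \<open>j \<le> k\<close> is at most \<open>B * |z| ^ (s - j)\<close>. The exponent is an integer because \<open>1 / R\<close> has degree \<open>-1\<close>. One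
  constant serves for all orders, so that products need only track a single number. The derivative is a witness
  \<open>g\<close> and not \<open>partial_deriv i f\<close>, so that only its values on \<open>U\<close> matter.
\<close>

primrec derivs_bounded ::
    "nat \<Rightarrow> (real^2) set \<Rightarrow> int \<Rightarrow> real \<Rightarrow> (real^2 \<Rightarrow> 'a::real_normed_vector) \<Rightarrow> bool" where
  "derivs_bounded 0 U s B f \<longleftrightarrow>
     continuous_on U f \<and> (\<forall>z\<in>U. norm (f z) \<le> B * norm z powi s)"
| "derivs_bounded (Suc k) U s B f \<longleftrightarrow>
     (continuous_on U f \<and> (\<forall>z\<in>U. norm (f z) \<le> B * norm z powi s)) \<and>
     (\<forall>i. \<exists>g. (\<forall>z\<in>U. has_partial i f (g z) z) \<and> derivs_bounded k U (s - 1) B g)"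

lemma derivs_boundedD:
  assumes "derivs_bounded k U s B f"
  shows "continuous_on U f" "\<And>z. z \<in> U \<Longrightarrow> norm (f z) \<le> B * norm z powi s"
  using assms by (cases k; simp)+

lemma derivs_bounded_partial:
  assumes "derivs_bounded (Suc k) U s B f"
  obtains g where "\<And>z. z \<in> U \<Longrightarrow> has_partial i f (g z) z" "derivs_bounded k U (s - 1) B g"
  using assms that unfolding derivs_bounded.simps by blast

lemma derivs_bounded_mono:
  assumes "derivs_bounded k U s B f" "B \<le> C"
  shows "derivs_bounded k U s C f"
  using assms
proof (induction k arbitrary: s f)
  case 0
  have "B * norm z powi s \<le> C * norm z powi s" for z :: "real^2"
    using 0 by (intro mult_right_mono) auto
  thus ?case using 0 by (force intro: order_trans)
next
  case (Suc k)
  have "B * norm z powi s \<le> C * norm z powi s" for z :: "real^2"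
    using Suc by (intro mult_right_mono) auto
  moreover have "\<exists>g. (\<forall>z\<in>U. has_partial i f (g z) z) \<and> derivs_bounded k U (s - 1) C g" for i
    by (rule derivs_bounded_partial[OF Suc.prems(1), of i]) (use Suc in blast)
  ultimately show ?case using Suc.prems by (force intro: order_trans)
qed

lemma derivs_bounded_Suc_imp:
  "derivs_bounded (Suc k) U s B f \<Longrightarrow> derivs_bounded k U s B f"
proof (induction k arbitrary: s f)
  case (Suc k)
  have "\<exists>g. (\<forall>z\<in>U. has_partial i f (g z) z) \<and> derivs_bounded k U (s - 1) B g" for i
    by (rule derivs_bounded_partial[OF Suc.prems, of i]) (use Suc.IH in blast)
  thus ?case using Suc.prems by simp
qed simp

lemma derivs_bounded_subset:
  assumes "derivs_bounded k U s B f" "V \<subseteq> U"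
  shows "derivs_bounded k V s B f"
  using assms(1)
proof (induction k arbitrary: s f)
  case 0
  thus ?case using assms(2) by (auto intro: continuous_on_subset)
next
  case (Suc k s f)
  have "\<exists>g. (\<forall>z\<in>V. has_partial i f (g z) z) \<and> derivs_bounded k V (s - 1) B g" for i
    by (rule derivs_bounded_partial[OF Suc.prems, of i]) (use Suc.IH assms(2) in blast)
  thus ?case using Suc.prems assms(2) by (auto intro: continuous_on_subset)
qed

lemma derivs_bounded_zero: "derivs_bounded k U s 0 (\<lambda>z. 0)"
proof (induction k arbitrary: s)
  case (Suc k)
  thus ?case by (auto intro!: exI[of _ "\<lambda>z. 0"] has_partial_const)
qed simp

lemma derivs_bounded_const: "derivs_bounded k U 0 (norm c) (\<lambda>z. c)"
proof (cases k)
  case (Suc k)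
  have "derivs_bounded k U (-1) (norm c) (\<lambda>z. 0 :: 'a)"
    by (rule derivs_bounded_mono[OF derivs_bounded_zero]) auto
  thus ?thesis using Suc by (auto intro!: exI[of _ "\<lambda>z. 0"] has_partial_const)
qed simp

lemma derivs_bounded_add:
  assumes "derivs_bounded k U s A f" "derivs_bounded k U s B g"
  shows "derivs_bounded k U s (A + B) (\<lambda>z. f z + g z)"
  using assms
proof (induction k arbitrary: s f g)
  case 0
  thus ?case
    by (auto intro!: continuous_intros norm_triangle_le add_mono simp: distrib_right)
next
  case (Suc k)
  have "\<exists>h. (\<forall>z\<in>U. has_partial i (\<lambda>z. f z + g z) (h z) z) \<and> derivs_bounded k U (s - 1) (A + B) h" for i
  proof -
    obtain f' where f': "\<And>z. z \<in> U \<Longrightarrow> has_partial i f (f' z) z" "derivs_bounded k U (s - 1) A f'"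
      by (rule derivs_bounded_partial[OF Suc.prems(1), of i], rule that)
    obtain g' where g': "\<And>z. z \<in> U \<Longrightarrow> has_partial i g (g' z) z" "derivs_bounded k U (s - 1) B g'"
      by (rule derivs_bounded_partial[OF Suc.prems(2), of i], rule that)
    show ?thesis
      by (intro exI[of _ "\<lambda>z. f' z + g' z"] conjI ballI has_partial_add f' g' Suc.IH)
  qed
  moreover have "derivs_bounded 0 U s (A + B) (\<lambda>z. f z + g z)"
    using Suc.prems by (auto intro!: continuous_intros norm_triangle_le add_mono simp: distrib_right)
  ultimately show ?case by simp
qed

lemma derivs_bounded_sum:
  assumes "finite I" "\<And>i. i \<in> I \<Longrightarrow> derivs_bounded k U s (B i) (f i)"
  shows "derivs_bounded k U s (\<Sum>i\<in>I. B i) (\<lambda>z. \<Sum>i\<in>I. f i z)"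
  using assms by (induction I rule: finite_induct) (auto intro: derivs_bounded_add derivs_bounded_zero)

text \<open>
  By Leibniz's rule a derivative of order \<open>j\<close> of a product is a sum of \<open>2 ^ j\<close> products, all of the same
  order of magnitude. The constant is therefore only multiplied by \<open>2 ^ k\<close>, and a product of \<open>N\<close>
  factors costs at most a geometric factor in \<open>N\<close>.
\<close>

lemma derivs_bounded_mult:
  fixes f g :: "real^2 \<Rightarrow> 'a::real_normed_algebra"
  assumes "derivs_bounded k U s A f" "derivs_bounded k U t B g" "0 \<le> A" "0 \<le> B" "0 \<notin> U"
  shows "derivs_bounded k U (s + t) (2 ^ k * A * B) (\<lambda>z. f z * g z)"
  using assms
proof (induction k arbitrary: s t f g)
  case (0 s t f g)
  have "norm (f z * g z) \<le> A * B * norm z powi (s + t)" if "z \<in> U" for z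
  proof -
    have "norm (f z * g z) \<le> (A * norm z powi s) * (B * norm z powi t)"
      using 0 that by (intro order_trans[OF norm_mult_ineq] mult_mono) auto
    moreover have "z \<noteq> 0" using that 0 by auto
    ultimately show ?thesis by (simp add: power_int_add mult_ac)
  qed
  thus ?case using 0 by (auto intro!: continuous_intros)
next
  case (Suc k s t f g)
  have "\<exists>h. (\<forall>z\<in>U. has_partial i (\<lambda>z. f z * g z) (h z) z) \<and>
      derivs_bounded k U (s + t - 1) (2 ^ Suc k * A * B) h" for i
  proof -
    obtain f' where f': "\<And>z. z \<in> U \<Longrightarrow> has_partial i f (f' z) z" "derivs_bounded k U (s - 1) A f'"
      by (rule derivs_bounded_partial[OF Suc.prems(1), of i], rule that)
    obtain g' where g': "\<And>z. z \<in> U \<Longrightarrow> has_partial i g (g' z) z" "derivs_bounded k U (t - 1) B g'"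
      by (rule derivs_bounded_partial[OF Suc.prems(2), of i], rule that)
    have "derivs_bounded k U (s + (t - 1)) (2 ^ k * A * B) (\<lambda>z. f z * g' z)"
      "derivs_bounded k U (s - 1 + t) (2 ^ k * A * B) (\<lambda>z. f' z * g z)"
      using Suc.prems f' g' by (auto intro!: Suc.IH intro: derivs_bounded_Suc_imp simp del: derivs_bounded.simps)
    hence "derivs_bounded k U (s + t - 1) (2 ^ k * A * B + 2 ^ k * A * B) (\<lambda>z. f z * g' z + f' z * g z)"
      by (intro derivs_bounded_add) (simp_all add: algebra_simps)
    moreover have "has_partial i (\<lambda>z. f z * g z) (f z * g' z + f' z * g z) z" if "z \<in> U" for z
      by (intro has_partial_mult f' g' that)
    moreover have "2 ^ k * A * B + 2 ^ k * A * B = 2 ^ Suc k * A * B" by simp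
    ultimately show ?thesis
      by (intro exI[of _ "\<lambda>z. f z * g' z + f' z * g z"] conjI ballI) (simp_all only:)
  qed
  moreover have "norm (f z * g z) \<le> 2 ^ Suc k * A * B * norm z powi (s + t)" if "z \<in> U" for z
  proof -
    have "norm (f z * g z) \<le> (A * norm z powi s) * (B * norm z powi t)"
      using Suc.prems that by (intro order_trans[OF norm_mult_ineq] mult_mono) auto
    also have "\<dots> = 1 * (A * B * norm z powi (s + t))"
      using that Suc.prems(5) by (subst power_int_add) (auto simp: mult_ac)
    also have "\<dots> \<le> 2 ^ Suc k * (A * B * norm z powi (s + t))"
      using Suc.prems by (intro mult_right_mono mult_nonneg_nonneg one_le_power) auto
    finally show ?thesis by (simp add: mult_ac)
  qed
  moreover have "continuous_on U (\<lambda>z. f z * g z)"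
    using Suc.prems by (auto intro!: continuous_intros)
  ultimately show ?case by simp
qed

lemma derivs_bounded_power:
  fixes f :: "real^2 \<Rightarrow> 'a::real_normed_algebra_1"
  assumes "derivs_bounded k U s B f" "0 \<le> B" "0 \<notin> U"
  shows "derivs_bounded k U (int N * s) ((2 ^ k * B) ^ N) (\<lambda>z. f z ^ N)"
proof (induction N)
  case 0
  show ?case using derivs_bounded_const[of k U "1::'a"] by simp
next
  case (Suc N)
  show ?case
    using derivs_bounded_mult[OF assms(1) Suc] assms by (auto simp: algebra_simps)
qed

lemma has_partial_coordinate:
  "has_partial i (\<lambda>z. of_real (z $ j) :: 'a::real_normed_algebra_1) (if i = j then 1 else 0) z"
proof -
  have "((\<lambda>t. of_real ((z + t *\<^sub>R axis i 1) $ j) :: 'a) has_vector_derivative of_real (axis i 1 $ j)) (at 0)"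
    by (auto intro!: derivative_eq_intros)
  thus ?thesis by (auto simp: has_partial_def axis_def)
qed

lemma derivs_bounded_coordinate:
  "derivs_bounded k U 1 1 (\<lambda>z. of_real (z $ j) :: 'a::real_normed_algebra_1)"
proof (cases k)
  case (Suc k)
  have "derivs_bounded k U 0 1 (\<lambda>z. if i = j then 1 else 0 :: 'a)" for i
    using derivs_bounded_mono[OF derivs_bounded_const[of k U "if i = j then 1 else 0 :: 'a"], of 1]
    by (auto split: if_splits)
  thus ?thesis
    using Suc has_partial_coordinate component_le_norm_cart
    by (auto intro!: continuous_intros exI[of _ "\<lambda>z. if _ = j then 1 else 0"])
qed (auto simp: component_le_norm_cart intro!: continuous_intros)

lemma derivs_bounded_linear:
  assumes "0 \<notin> U"
  shows "\<exists>B\<ge>0. derivs_bounded k U 1 B (\<lambda>z. of_real (x * z$1 + y * z$2) :: 'a::real_normed_algebra_1)"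
proof -
  have "derivs_bounded k U (0 + 1) (2 ^ k * norm (of_real r :: 'a) * 1)
      (\<lambda>z. of_real r * of_real (z $ j) :: 'a)" for r j
    by (intro derivs_bounded_mult derivs_bounded_const derivs_bounded_coordinate) (use assms in auto)
  from derivs_bounded_add[OF this[of x 1] this[of y 2]] show ?thesis
    by (intro exI[of _ "2 ^ k * norm (of_real x :: 'a) * 1 + 2 ^ k * norm (of_real y :: 'a) * 1"]) auto
qed

section \<open>The reciprocal of R\<close>

text \<open>
  The quadratic form under the root is positive definite, hence bounded below by a multiple of \<open>|z|\<^sup>2\<close>.
\<close>

lemma R_lower_bound:
  assumes "a > 0" "c > 0" "4 * a * c - b\<^sup>2 > 0"
  shows "\<exists>\<kappa>>0. \<forall>z. \<kappa> * norm z \<le> R a b c z"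
proof -
  \<comment> \<open>The determinant of the form divided by its trace, a lower bound for the smallest eigenvalue.\<close>
  define \<mu> where "\<mu> = (4 * a * c - b\<^sup>2) / (4 * (a + c))"
  have \<mu>: "\<mu> > 0" using assms by (auto simp: \<mu>_def)
  have "sqrt \<mu> * norm z \<le> R a b c z" for z :: "real^2"
  proof -
    let ?x = "z $ 1" and ?y = "z $ 2"
    have "(a + c) * (a * ?x\<^sup>2 + b * ?x * ?y + c * ?y\<^sup>2) =
        (a * ?x + b * ?y / 2)\<^sup>2 + (c * ?y + b * ?x / 2)\<^sup>2 + (a * c - b\<^sup>2 / 4) * (?x\<^sup>2 + ?y\<^sup>2)"
      by (simp add: power2_eq_square field_simps)
    hence "(a * c - b\<^sup>2 / 4) * (?x\<^sup>2 + ?y\<^sup>2) \<le> (a + c) * (a * ?x\<^sup>2 + b * ?x * ?y + c * ?y\<^sup>2)"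
      by simp
    moreover have "(a + c) * \<mu> = a * c - b\<^sup>2 / 4"
      using assms by (simp add: \<mu>_def field_simps)
    ultimately have "(a + c) * (\<mu> * (?x\<^sup>2 + ?y\<^sup>2)) \<le> (a + c) * (a * ?x\<^sup>2 + b * ?x * ?y + c * ?y\<^sup>2)"
      by (simp add: mult.assoc[symmetric])
    hence "\<mu> * (?x\<^sup>2 + ?y\<^sup>2) \<le> a * ?x\<^sup>2 + b * ?x * ?y + c * ?y\<^sup>2"
      using assms by (simp add: mult_le_cancel_left)
    hence "sqrt (\<mu> * (?x\<^sup>2 + ?y\<^sup>2)) \<le> R a b c z"
      unfolding R_def by (rule real_sqrt_le_mono)
    thus ?thesis
      by (simp add: norm_vec_def L2_set_def sum_2 real_sqrt_mult)
  qed
  thus ?thesis using \<mu> by (intro exI[of _ "sqrt \<mu>"]) auto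
qed

lemma continuous_on_R [continuous_intros]:
  assumes "continuous_on S f" shows "continuous_on S (\<lambda>x. R a b c (f x))"
  unfolding R_def by (intro continuous_intros assms)

text \<open>
  The derivative of \<open>1 / R\<close> is a linear form times \<open>(1 / R) ^ 3\<close>, so the derivatives of \<open>1 / R\<close> are
  polynomials in \<open>1 / R\<close> and the coordinates.
\<close>

lemma has_partial_inverse_R:
  assumes "R a b c z > 0"
  shows "has_partial i (\<lambda>z. of_real (inverse (R a b c z)) :: 'a::real_normed_field)
     (of_real ((if i = 1 then - a else - b / 2) * z$1 + (if i = 1 then - b / 2 else - c) * z$2)
        * of_real (inverse (R a b c z)) ^ 3) z"
proof -
  have pos: "a * (z$1)\<^sup>2 + b * z$1 * z$2 + c * (z$2)\<^sup>2 > 0"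
    using assms by (simp add: R_def)
  define q where "q w = a * (w$1)\<^sup>2 + b * w$1 * w$2 + c * (w$2)\<^sup>2" for w :: "real^2"
  let ?v = "(if i = 1 then - a else - b / 2) * z$1 + (if i = 1 then - b / 2 else - c) * z$2"
  have "((\<lambda>x. inverse (sqrt x)) has_real_derivative (- 1 / 2) * inverse (sqrt (q z)) ^ 3) (at (q z))"
    using pos unfolding q_def[symmetric]
    by (auto intro!: derivative_eq_intros simp: field_simps power2_eq_square power3_eq_cube)
  hence "((\<lambda>x. inverse (sqrt x)) has_real_derivative (- 1 / 2) * inverse (sqrt (q z)) ^ 3)
      (at (q (z + 0 *\<^sub>R axis i 1)))"
    by simp
  moreover have "((\<lambda>t. q (z + t *\<^sub>R axis i 1)) has_real_derivative - 2 * ?v) (at 0)"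
    using exhaust_2[of i] unfolding q_def
    by (auto intro!: derivative_eq_intros simp: axis_def field_simps)
  ultimately have "((\<lambda>t. inverse (sqrt (q (z + t *\<^sub>R axis i 1)))) has_real_derivative
      (- 1 / 2) * inverse (sqrt (q z)) ^ 3 * (- 2 * ?v)) (at 0)"
    by (rule DERIV_chain2)
  moreover have "R a b c w = sqrt (q w)" for w by (simp add: R_def q_def)
  moreover have "(- 1 / 2) * x ^ 3 * (- 2 * y) = y * x ^ 3" for x y :: real by simp
  ultimately have "((\<lambda>t. inverse (R a b c (z + t *\<^sub>R axis i 1))) has_real_derivative
      ?v * inverse (R a b c z) ^ 3) (at 0)"
    by (simp only:)
  from has_vector_derivative_of_real[OF this, where 'a = 'a]
  show ?thesis by (simp add: has_partial_def)
qed

text \<open>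
  Induction on the order: if \<open>1 / R\<close> satisfies the bounds up to order \<open>k\<close>, then so does its derivative,
  being a product of functions that do, and this gives order \<open>k + 1\<close>.
\<close>

lemma derivs_bounded_inverse_R:
  assumes "a > 0" "c > 0" "4 * a * c - b\<^sup>2 > 0" "0 \<notin> U"
  shows "\<exists>B\<ge>0. derivs_bounded k U (-1) B (\<lambda>z. of_real (inverse (R a b c z)) :: 'a::real_normed_field)"
proof -
  let ?W = "\<lambda>z. of_real (inverse (R a b c z)) :: 'a"
  obtain \<kappa> where \<kappa>: "\<kappa> > 0" "\<And>z. \<kappa> * norm z \<le> R a b c z"
    using R_lower_bound assms by blast
  have pos: "R a b c z > 0" if "z \<in> U" for z
    using \<kappa> that assms by (metis mult_pos_pos order_less_le_trans zero_less_norm_iff)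
  have cont: "continuous_on U ?W"
    by (intro continuous_intros) (use pos in force)+
  have bound: "norm (?W z) \<le> inverse \<kappa> * norm z powi (-1)" if "z \<in> U" for z
  proof -
    have "inverse (R a b c z) \<le> inverse (\<kappa> * norm z)"
      using \<kappa> that assms by (intro le_imp_inverse_le) (auto intro!: mult_pos_pos)
    thus ?thesis using pos[OF that] by (simp add: power_int_minus norm_inverse)
  qed
  show ?thesis
  proof (induction k)
    case 0
    show ?case using cont bound \<kappa> by (intro exI[of _ "inverse \<kappa>"]) auto
  next
    case (Suc k)
    then obtain B where B: "B \<ge> 0" "derivs_bounded k U (-1) B ?W" by auto
    define v where "v i z = ((if i = 1 then - a else - b / 2) * z$1 + (if i = 1 then - b / 2 else - c) * z$2)"
      for i :: 2 and z :: "real^2"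
    have "\<exists>C\<ge>0. derivs_bounded k U 1 C (\<lambda>z. of_real (v i z) :: 'a)" for i
      using derivs_bounded_linear[OF assms(4), where 'a = 'a] unfolding v_def by blast
    then obtain C where C: "\<And>i. C i \<ge> 0" "\<And>i. derivs_bounded k U 1 (C i) (\<lambda>z. of_real (v i z) :: 'a)"
      by metis
    have part: "has_partial i ?W (of_real (v i z) * ?W z ^ 3) z" if "z \<in> U" for i z
      unfolding v_def by (rule has_partial_inverse_R[OF pos[OF that]])
    define A where "A i = 2 ^ k * C i * (2 ^ k * B) ^ 3" for i
    have A: "derivs_bounded k U (1 + int 3 * - 1) (A i) (\<lambda>z. of_real (v i z) * ?W z ^ 3)" for i
      unfolding A_def using B C assms by (intro derivs_bounded_mult derivs_bounded_power) auto
    have "A i \<ge> 0" for i using B C by (simp add: A_def)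
    hence le: "A i \<le> inverse \<kappa> + A 1 + A 2" "inverse \<kappa> \<le> inverse \<kappa> + A 1 + A 2" for i
      using exhaust_2[of i] \<kappa> by (auto simp: add_nonneg_nonneg)
    have le': "inverse \<kappa> * norm z powi (-1) \<le> (inverse \<kappa> + A 1 + A 2) * norm z powi (-1)" for z :: "real^2"
      using le by (intro mult_right_mono) auto
    show ?case
    proof (intro exI[of _ "inverse \<kappa> + A 1 + A 2"] conjI)
      show "derivs_bounded (Suc k) U (-1) (inverse \<kappa> + A 1 + A 2) ?W"
        unfolding derivs_bounded.simps
      proof (intro conjI ballI allI cont)
        fix i
        show "\<exists>g. (\<forall>z\<in>U. has_partial i ?W (g z) z) \<and> derivs_bounded k U (- 1 - 1) (inverse \<kappa> + A 1 + A 2) g"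
          using derivs_bounded_mono[OF A[of i] le(1)] part
          by (intro exI[of _ "\<lambda>z. of_real (v i z) * ?W z ^ 3"] conjI ballI) simp_all
      qed (use bound le' in \<open>blast intro: order_trans\<close>)
    qed (use \<kappa> le(2) in \<open>auto intro: order_trans\<close>)
  qed
qed

section \<open>Termwise differentiation and extension to the origin\<close>

lemma has_partial_line:
  assumes "has_partial i f D (z + t *\<^sub>R axis i 1)"
  shows "((\<lambda>u. f (z + u *\<^sub>R axis i 1)) has_vector_derivative D) (at t)"
proof -
  have "((\<lambda>u. u - t) has_vector_derivative 1) (at t)"
    by (auto intro!: derivative_eq_intros)
  moreover have "((\<lambda>v. f (z + t *\<^sub>R axis i 1 + v *\<^sub>R axis i 1)) has_vector_derivative D) (at (t - t))"
    using assms by (simp add: has_partial_def)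
  ultimately have "((\<lambda>v. f (z + t *\<^sub>R axis i 1 + v *\<^sub>R axis i 1)) \<circ> (\<lambda>u. u - t)
      has_vector_derivative 1 *\<^sub>R D) (at t)"
    by (rule vector_diff_chain_at)
  thus ?thesis by (simp add: o_def scaleR_left_distrib[symmetric] add.assoc)
qed

text \<open>
  Restricted to a line in direction \<open>i\<close>, this is termwise differentiation of a series of functions of one
  real variable whose derivatives converge uniformly.
\<close>

lemma has_partial_series:
  fixes f :: "nat \<Rightarrow> real^2 \<Rightarrow> 'a::banach"
  assumes "open U" "z \<in> U"
    and partial: "\<And>n w. w \<in> U \<Longrightarrow> has_partial i (f n) (g n w) w"
    and summable: "\<And>w. w \<in> U \<Longrightarrow> summable (\<lambda>n. f n w)"
    and unif: "uniform_limit U (\<lambda>n w. \<Sum>j<n. g j w) (\<lambda>w. \<Sum>j. g j w) sequentially"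
  shows "has_partial i (\<lambda>w. \<Sum>n. f n w) (\<Sum>n. g n z) z"
proof -
  let ?l = "\<lambda>t. z + t *\<^sub>R axis i 1"
  have "open (?l -` U)"
    by (intro open_vimage assms continuous_intros)
  moreover have "0 \<in> ?l -` U" using \<open>z \<in> U\<close> by simp
  ultimately obtain r where r: "r > 0" "ball 0 r \<subseteq> ?l -` U"
    by (rule openE)
  define S where "S = ball (0::real) r"
  have S: "?l t \<in> U" if "t \<in> S" for t using r that by (auto simp: S_def)
  have "\<exists>G. \<forall>t\<in>S. (\<lambda>n. f n (?l t)) sums G t \<and>
      (G has_derivative (\<lambda>h. h *\<^sub>R (\<Sum>n. g n (?l t)))) (at t within S)"
  proof (rule has_derivative_series[where f = "\<lambda>n t. f n (?l t)" and f' = "\<lambda>n t h. h *\<^sub>R g n (?l t)"])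
    show "convex S" by (simp add: S_def)
    show "((\<lambda>t. f n (?l t)) has_derivative (\<lambda>h. h *\<^sub>R g n (?l t))) (at t within S)" if "t \<in> S" for n t
      using has_partial_line[OF partial[OF S[OF that]]]
      by (simp add: has_vector_derivative_def has_derivative_at_withinI)
    show "\<forall>\<^sub>F n in sequentially. \<forall>t\<in>S. \<forall>h.
        norm ((\<Sum>j<n. h *\<^sub>R g j (?l t)) - h *\<^sub>R (\<Sum>j. g j (?l t))) \<le> e * norm h" if "e > 0" for e
    proof (rule eventually_mono[OF uniform_limitD[OF unif that]], intro ballI allI)
      fix n t h
      assume *: "\<forall>w\<in>U. dist (\<Sum>j<n. g j w) (\<Sum>j. g j w) < e" and "t \<in> S"
      have "norm ((\<Sum>j<n. h *\<^sub>R g j (?l t)) - h *\<^sub>R (\<Sum>j. g j (?l t))) =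
          \<bar>h\<bar> * dist (\<Sum>j<n. g j (?l t)) (\<Sum>j. g j (?l t))"
        by (simp add: scaleR_sum_right[symmetric] scaleR_diff_right[symmetric] dist_norm)
      also have "\<dots> \<le> \<bar>h\<bar> * e"
        using * S[OF \<open>t \<in> S\<close>] by (intro mult_left_mono) (auto intro: less_imp_le)
      finally show "norm ((\<Sum>j<n. h *\<^sub>R g j (?l t)) - h *\<^sub>R (\<Sum>j. g j (?l t))) \<le> e * norm h"
        by (simp add: mult_ac)
    qed
    show "0 \<in> S" "(\<lambda>n. f n (?l 0)) sums (\<Sum>n. f n (?l 0))"
      using r \<open>z \<in> U\<close> summable by (auto simp: S_def)
  qed
  then obtain G where G: "\<forall>t\<in>S. (\<lambda>n. f n (?l t)) sums G t \<and>
      (G has_derivative (\<lambda>h. h *\<^sub>R (\<Sum>n. g n (?l t)))) (at t within S)" ..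
  have "0 \<in> S" "open S" using r by (auto simp: S_def)
  hence "(G has_vector_derivative (\<Sum>n. g n z)) (at 0)"
    using conjunct2[OF bspec[OF G \<open>0 \<in> S\<close>]]
    by (simp add: has_vector_derivative_def at_within_open[OF \<open>0 \<in> S\<close> \<open>open S\<close>])
  hence "((\<lambda>t. \<Sum>n. f n (?l t)) has_vector_derivative (\<Sum>n. g n z)) (at 0)"
    using \<open>open S\<close> \<open>0 \<in> S\<close>
    by (rule has_vector_derivative_transform_within_open) (use G in \<open>simp add: sums_iff\<close>)
  thus ?thesis by (simp add: has_partial_def)
qed

text \<open>
  The terms decay geometrically with ratio \<open>C * |z| \<le> 1 / 2\<close>, and this survives up to \<open>k\<close>
  differentiations since these only lower the power of \<open>|z|\<close> common to all terms. The hypothesis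
  \<open>k \<le> s\<close> keeps that power nonnegative, so the convergence is uniform up to the origin.
\<close>

lemma derivs_bounded_series:
  fixes f :: "nat \<Rightarrow> real^2 \<Rightarrow> 'a::banach"
  assumes "\<And>l. derivs_bounded k (ball 0 \<delta> - {0}) (s + int l) (M * C ^ l) (f l)"
    and "int k \<le> s" "0 \<le> M" "0 \<le> C" "\<delta> \<le> 1" "C * \<delta> \<le> 1 / 2"
  shows "derivs_bounded k (ball 0 \<delta> - {0}) s (2 * M) (\<lambda>z. \<Sum>l. f l z)"
proof -
  define U :: "(real^2) set" where "U = ball 0 \<delta> - {0}"
  have half: "M * C ^ l * norm z powi (s + int l) \<le> (M * norm z powi s) * (1 / 2) ^ l"
    if "z \<in> U" for z l s
  proof -
    have "z \<noteq> 0" "norm z \<le> \<delta>" using that by (auto simp: U_def)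
    have "C * norm z \<le> C * \<delta>" using \<open>norm z \<le> \<delta>\<close> assms by (intro mult_left_mono) auto
    hence "(C * norm z) ^ l \<le> (1 / 2) ^ l"
      using assms by (intro power_mono) auto
    hence "(M * norm z powi s) * (C * norm z) ^ l \<le> (M * norm z powi s) * (1 / 2) ^ l"
      using assms by (intro mult_left_mono) auto
    thus ?thesis using \<open>z \<noteq> 0\<close> by (simp add: power_int_add power_mult_distrib mult_ac)
  qed
  have geo: "(\<lambda>l. A * (1 / 2) ^ l) sums (2 * A)" for A :: real
    using sums_mult[OF geometric_sums[of "1 / 2 :: real"], of A] by (simp add: mult.commute)
  have summable: "summable (\<lambda>l. f l z)" and norm_le: "norm (\<Sum>l. f l z) \<le> 2 * M * norm z powi s"
    if "z \<in> U" "\<And>l. norm (f l z) \<le> M * C ^ l * norm z powi (s + int l)"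
    for s z and f :: "nat \<Rightarrow> real^2 \<Rightarrow> 'a"
  proof -
    have le: "norm (f l z) \<le> (M * norm z powi s) * (1 / 2) ^ l" for l
      using half[OF that(1)] that(2) by (rule order_trans[rotated])
    show "summable (\<lambda>l. f l z)"
      by (rule summable_comparison_test'[OF sums_summable[OF geo] le])
    show "norm (\<Sum>l. f l z) \<le> 2 * M * norm z powi s"
      using norm_suminf_le[OF le sums_summable[OF geo]] sums_unique[OF geo, of "M * norm z powi s"]
      by (simp only: mult_ac)
  qed
  have uniform: "uniform_limit U (\<lambda>n z. \<Sum>l<n. f l z) (\<lambda>z. \<Sum>l. f l z) sequentially"
    if bound: "\<And>l z. z \<in> U \<Longrightarrow> norm (f l z) \<le> M * C ^ l * norm z powi (s + int l)" and "0 \<le> s"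
    for s and f :: "nat \<Rightarrow> real^2 \<Rightarrow> 'a"
  proof (rule Weierstrass_m_test)
    show "norm (f l z) \<le> M * (1 / 2) ^ l" if "z \<in> U" for l z
    proof -
      have "norm (f l z) \<le> (M * norm z powi s) * (1 / 2) ^ l"
        using half[OF \<open>z \<in> U\<close>] bound[OF \<open>z \<in> U\<close>] by (rule order_trans[rotated])
      also have "\<dots> \<le> (M * 1) * (1 / 2) ^ l"
        using \<open>z \<in> U\<close> \<open>0 \<le> s\<close> assms
        by (intro mult_right_mono mult_left_mono power_int_le_one) (auto simp: U_def)
      finally show ?thesis by simp
    qed
    show "summable (\<lambda>l. M * (1 / 2) ^ l)" using geo by (auto simp: sums_iff)
  qed
  have "open U" by (auto simp: U_def)
  have "derivs_bounded k U s (2 * M) (\<lambda>z. \<Sum>l. f l z)"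
    using assms(1,2) unfolding U_def[symmetric]
  proof (induction k arbitrary: s f)
    case (0 s f)
    note bd = derivs_boundedD(2)[OF 0(1)]
    have "0 \<le> s" using 0(2) by simp
    have "continuous_on U (\<lambda>z. \<Sum>l. f l z)"
    proof (rule uniform_limit_theorem)
      show "\<forall>\<^sub>F n in sequentially. continuous_on U (\<lambda>z. \<Sum>l<n. f l z)"
        by (intro always_eventually allI continuous_on_sum derivs_boundedD(1)[OF 0(1)])
      show "uniform_limit U (\<lambda>n z. \<Sum>l<n. f l z) (\<lambda>z. \<Sum>l. f l z) sequentially"
        by (rule uniform[OF bd \<open>0 \<le> s\<close>])
    qed simp
    moreover have "norm (\<Sum>l. f l z) \<le> 2 * M * norm z powi s" if "z \<in> U" for z
      by (rule norm_le[OF that]) (rule bd[OF that])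
    ultimately show ?case by simp
  next
    case (Suc k s f)
    note bd = derivs_boundedD(2)[OF Suc.prems(1)]
    have "0 \<le> s" "0 \<le> s - 1" using Suc.prems(2) by simp_all
    have cont: "continuous_on U (\<lambda>z. \<Sum>l. f l z)"
    proof (rule uniform_limit_theorem)
      show "\<forall>\<^sub>F n in sequentially. continuous_on U (\<lambda>z. \<Sum>l<n. f l z)"
        by (intro always_eventually allI continuous_on_sum derivs_boundedD(1)[OF Suc.prems(1)])
      show "uniform_limit U (\<lambda>n z. \<Sum>l<n. f l z) (\<lambda>z. \<Sum>l. f l z) sequentially"
        by (rule uniform[OF bd \<open>0 \<le> s\<close>])
    qed simp
    have "\<exists>g. (\<forall>z\<in>U. has_partial i (\<lambda>z. \<Sum>l. f l z) (g z) z) \<and> derivs_bounded k U (s - 1) (2 * M) g" for i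
    proof -
      have "\<forall>l. \<exists>g. (\<forall>z\<in>U. has_partial i (f l) (g z) z) \<and>
          derivs_bounded k U (s + int l - 1) (M * C ^ l) g"
      proof
        fix l
        show "\<exists>g. (\<forall>z\<in>U. has_partial i (f l) (g z) z) \<and>
            derivs_bounded k U (s + int l - 1) (M * C ^ l) g"
          by (rule derivs_bounded_partial[OF Suc.prems(1)[of l], of i]) blast
      qed
      from choice[OF this] obtain g where g: "\<forall>l. (\<forall>z\<in>U. has_partial i (f l) (g l z) z) \<and>
          derivs_bounded k U (s + int l - 1) (M * C ^ l) (g l)" ..
      have g': "derivs_bounded k U ((s - 1) + int l) (M * C ^ l) (g l)" for l
        using g by (simp add: algebra_simps)
      have "derivs_bounded k U (s - 1) (2 * M) (\<lambda>z. \<Sum>l. g l z)"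
        using Suc.IH[OF g'] Suc.prems(2) by simp
      moreover have "has_partial i (\<lambda>z. \<Sum>l. f l z) (\<Sum>l. g l z) z" if "z \<in> U" for z
      proof (rule has_partial_series[OF \<open>open U\<close> that])
        show "has_partial i (f l) (g l w) w" if "w \<in> U" for l w
          using g that by blast
        show "summable (\<lambda>l. f l w)" if "w \<in> U" for w
          by (rule summable[OF that]) (rule bd[OF that])
        show "uniform_limit U (\<lambda>n w. \<Sum>l<n. g l w) (\<lambda>w. \<Sum>l. g l w) sequentially"
          by (rule uniform[OF derivs_boundedD(2)[OF g'] \<open>0 \<le> s - 1\<close>])
      qed
      ultimately show ?thesis
        by (intro exI[of _ "\<lambda>z. \<Sum>l. g l z"] conjI ballI)
    qed
    moreover have "norm (\<Sum>l. f l z) \<le> 2 * M * norm z powi s" if "z \<in> U" for z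
      by (rule norm_le[OF that]) (rule bd[OF that])
    ultimately show ?case using cont by simp
  qed
  thus ?thesis by (simp add: U_def)
qed

text \<open>
  A derivative of order \<open>j\<close> is \<open>O(|z| ^ (s - j))\<close>. For \<open>j \<le> k < s\<close> it tends to \<open>0\<close> at the origin, and for
  \<open>j < k\<close> it is \<open>O(|z|\<^sup>2)\<close>, so its extension by \<open>0\<close> has vanishing partial derivatives there. The function
  \<open>F\<close> is only related to \<open>f\<close> near the origin, which lets the induction pass from \<open>F\<close> to
  \<open>partial_deriv i F\<close>. The list records the order in which partial derivatives are taken.
\<close>

lemma flat_extension:
  assumes "derivs_bounded k (ball 0 \<delta> - {0}) s B f" "int k < s"
    and "0 \<le> B" "0 < \<delta>" "\<delta> \<le> 1"
    and "\<And>z. z \<in> ball 0 \<delta> - {0} \<Longrightarrow> F z = f z" "F 0 = 0"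
  shows "Ck_on k (ball 0 \<delta>) F \<and> (\<forall>is. length is \<le> k \<longrightarrow> fold partial_deriv is F 0 = 0)"
proof -
  define U :: "(real^2) set" where "U = ball 0 \<delta> - {0}"
  have "open U" by (auto simp: U_def)
  have decay: "norm (F z) \<le> B * norm z ^ j"
    if "derivs_bounded k U s B f" "int j \<le> s" "\<And>z. z \<in> U \<Longrightarrow> F z = f z" "z \<in> U"
    for k j s z and f F :: "real^2 \<Rightarrow> 'a"
  proof -
    have "norm (F z) \<le> B * norm z powi s"
      using derivs_boundedD(2)[OF that(1)] that by simp
    also have "\<dots> \<le> B * norm z powi (int j)"
      using that assms by (intro mult_left_mono power_int_decreasing) (auto simp: U_def)
    finally show ?thesis by simp
  qed
  have near: "\<forall>\<^sub>F z in at 0. z \<in> U"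
    using eventually_at_ball[OF \<open>\<delta> > 0\<close>, of 0 UNIV] unfolding U_def
    by (auto simp: eventually_at_filter elim: eventually_mono)
  have cont: "continuous_on (ball 0 \<delta>) F"
    if "derivs_bounded k U s B f" "1 \<le> s" "\<And>z. z \<in> U \<Longrightarrow> F z = f z" "F 0 = 0"
    for k s and f F :: "real^2 \<Rightarrow> 'a"
  proof -
    have "isCont F z" if "z \<in> ball 0 \<delta>" for z
    proof (cases "z = 0")
      case True
      have "\<forall>\<^sub>F z in at 0. norm (F z) \<le> B * norm z ^ 1"
        by (rule eventually_mono[OF near]) (rule decay[OF \<open>derivs_bounded k U s B f\<close>], use \<open>1 \<le> s\<close> \<open>\<And>z. z \<in> U \<Longrightarrow> F z = f z\<close> in auto)
      moreover have "((\<lambda>z::real^2. B * norm z ^ 1) \<longlongrightarrow> 0) (at 0)"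
        by (auto intro!: tendsto_eq_intros)
      ultimately have "(F \<longlongrightarrow> 0) (at 0)" by (rule Lim_null_comparison)
      thus ?thesis using True \<open>F 0 = 0\<close> by (simp add: isCont_def)
    next
      case False
      have "continuous_on U F"
        using derivs_boundedD(1)[OF \<open>derivs_bounded k U s B f\<close>] \<open>\<And>z. z \<in> U \<Longrightarrow> F z = f z\<close>
        by (simp cong: continuous_on_cong)
      thus ?thesis
        using False that \<open>open U\<close> by (simp add: continuous_on_eq_continuous_at U_def)
    qed
    thus ?thesis by (simp add: continuous_at_imp_continuous_on)
  qed
  have partial_0: "has_partial i F 0 0"
    if "derivs_bounded k U s B f" "2 \<le> s" "\<And>z. z \<in> U \<Longrightarrow> F z = f z" "F 0 = 0"
    for k s i and f F :: "real^2 \<Rightarrow> 'a"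
  proof -
    have "\<forall>\<^sub>F t in at (0::real). norm (norm (F (t *\<^sub>R axis i 1)) / \<bar>t\<bar>) \<le> B * \<bar>t\<bar>"
    proof -
      have "\<forall>\<^sub>F t in at (0::real). t \<in> ball 0 \<delta> - {0}"
        using eventually_at_ball[OF \<open>\<delta> > 0\<close>, of "0::real" UNIV]
        by (auto simp: eventually_at_filter elim: eventually_mono)
      thus ?thesis
      proof (rule eventually_mono)
        fix t assume t: "t \<in> ball (0::real) \<delta> - {0}"
        have "norm (t *\<^sub>R axis i 1 :: real^2) = \<bar>t\<bar>" by (simp add: norm_axis_1)
        hence "norm (F (t *\<^sub>R axis i 1)) \<le> B * \<bar>t\<bar> ^ 2"
          using decay[OF that(1), of 2 F "t *\<^sub>R axis i 1"] that t by (auto simp: U_def)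
        thus "norm (norm (F (t *\<^sub>R axis i 1)) / \<bar>t\<bar>) \<le> B * \<bar>t\<bar>"
          using t by (simp add: field_simps power2_eq_square)
      qed
    qed
    moreover have "((\<lambda>t::real. B * \<bar>t\<bar>) \<longlongrightarrow> 0) (at 0)"
      by (auto intro!: tendsto_eq_intros)
    ultimately have "((\<lambda>t. norm (F (t *\<^sub>R axis i 1)) / \<bar>t\<bar>) \<longlongrightarrow> 0) (at 0)"
      by (rule Lim_null_comparison)
    thus ?thesis
      using \<open>F 0 = 0\<close> by (simp add: has_partial_def has_vector_derivative_def has_derivative_at)
  qed
  have "Ck_on k (ball 0 \<delta>) F \<and> (\<forall>is. length is \<le> k \<longrightarrow> fold partial_deriv is F 0 = 0)"
    using assms(1,2,6,7) unfolding U_def[symmetric]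
  proof (induction k arbitrary: s f F)
    case (0 s f F)
    thus ?case using cont[OF 0(1)] by simp
  next
    case (Suc k s f F)
    have *: "Ck_on k (ball 0 \<delta>) (partial_deriv i F) \<and>
        (\<forall>is. length is \<le> k \<longrightarrow> fold partial_deriv is (partial_deriv i F) 0 = 0) \<and>
        (\<forall>z\<in>ball 0 \<delta>. has_partial_deriv i F z)" for i
    proof -
      obtain g where g: "\<And>z. z \<in> U \<Longrightarrow> has_partial i f (g z) z" "derivs_bounded k U (s - 1) B g"
        by (rule derivs_bounded_partial[OF Suc.prems(1), of i], rule that)
      have part: "has_partial i F (g z) z" if "z \<in> U" for z
        using has_partial_transform[OF g(1)[OF that] \<open>open U\<close> that, of F] Suc.prems(3) by simp
      have part0: "has_partial i F 0 0"
        using partial_0[OF Suc.prems(1)] Suc.prems by simp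
      have "has_partial_deriv i F z" if "z \<in> ball 0 \<delta>" for z
        using part[of z] part0 that by (cases "z = 0") (auto simp: U_def dest: has_partial_imp(1))
      moreover have "Ck_on k (ball 0 \<delta>) (partial_deriv i F) \<and>
        (\<forall>is. length is \<le> k \<longrightarrow> fold partial_deriv is (partial_deriv i F) 0 = 0)"
        by (rule Suc.IH[OF g(2)])
           (use Suc.prems(2) has_partial_imp(2)[OF part] has_partial_imp(2)[OF part0] in auto)
      ultimately show ?thesis by blast
    qed
    have "fold partial_deriv is F 0 = 0" if "length is \<le> Suc k" for "is"
      using that * Suc.prems(4) by (cases "is") auto
    moreover have "continuous_on (ball 0 \<delta>) F"
      using cont[OF Suc.prems(1)] Suc.prems by simp
    ultimately show ?case using * by simp
  qed
  thus ?thesis .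
qed

lemma multi_deriv_eq_fold:
  "multi_deriv \<alpha> f = fold partial_deriv (replicate (snd \<alpha>) 2 @ replicate (fst \<alpha>) 1) f"
proof -
  have "fold h (replicate n i) x = (h i ^^ n) x" for h :: "2 \<Rightarrow> (real^2 \<Rightarrow> 'a) \<Rightarrow> real^2 \<Rightarrow> 'a" and n i x
    by (induction n arbitrary: x) (auto simp: funpow_swap1)
  thus ?thesis by (simp add: multi_deriv_def)
qed

section \<open>Polynomials bounded on an interval\<close>

text \<open>
  The closed sets \<open>T N\<close> on which all \<open>f l\<close> are at most \<open>N\<close> cover the interval. If none of them contained
  a subinterval, their complements would be dense, against Baire's theorem.
\<close>

lemma bounded_on_subinterval:
  fixes f :: "nat \<Rightarrow> real \<Rightarrow> real"
  assumes "\<alpha> < \<beta>" "\<And>l. continuous_on {\<alpha>..\<beta>} (f l)"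
    and bounded: "\<And>y. y \<in> {\<alpha>..\<beta>} \<Longrightarrow> \<exists>M. \<forall>l. f l y \<le> M"
  shows "\<exists>\<alpha>' \<beta>' M. \<alpha>' < \<beta>' \<and> {\<alpha>'..\<beta>'} \<subseteq> {\<alpha>..\<beta>} \<and> (\<forall>l. \<forall>y\<in>{\<alpha>'..\<beta>'}. f l y \<le> M)"
proof (rule ccontr)
  assume unb: "\<not> ?thesis"
  define T where "T N = {y \<in> {\<alpha>..\<beta>}. \<forall>l. f l y \<le> real N}" for N :: nat
  have closed: "closed (T N)" for N
  proof -
    have "T N = (\<Inter>l. {\<alpha>..\<beta>} \<inter> f l -` {..real N})" by (auto simp: T_def)
    also have "closed \<dots>"
      by (intro closed_INT ballI continuous_closed_preimage assms) auto
    finally show ?thesis .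
  qed
  have "{\<alpha>..\<beta>} \<subseteq> closure (\<Inter>(range (\<lambda>N. {\<alpha>..\<beta>} - T N)))"
  proof (rule Baire)
    fix V assume "V \<in> range (\<lambda>N. {\<alpha>..\<beta>} - T N)"
    then obtain N where V: "V = {\<alpha>..\<beta>} - T N" by auto
    have "openin (top_of_set {\<alpha>..\<beta>}) V"
      unfolding V using closed[of N] by (intro openin_diff) (auto simp: T_def closedin_closed_eq)
    moreover have "{\<alpha>..\<beta>} \<subseteq> closure V"
    proof (rule ccontr)
      assume "\<not> {\<alpha>..\<beta>} \<subseteq> closure V"
      then obtain x where x: "x \<in> {\<alpha>..\<beta>}" "x \<notin> closure V" by blast
      then obtain e where e: "e > 0" "\<forall>y\<in>V. e \<le> dist y x"
        by (auto simp: closure_approachable not_less)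
      define \<alpha>' \<beta>' where "\<alpha>' = max \<alpha> (x - e / 2)" and "\<beta>' = min \<beta> (x + e / 2)"
      have "\<alpha>' < \<beta>'" using x e \<open>\<alpha> < \<beta>\<close> by (auto simp: \<alpha>'_def \<beta>'_def)
      moreover have sub: "{\<alpha>'..\<beta>'} \<subseteq> {\<alpha>..\<beta>}" by (auto simp: \<alpha>'_def \<beta>'_def)
      moreover have "f l y \<le> real N" if "y \<in> {\<alpha>'..\<beta>'}" for l y
      proof -
        have "dist y x < e" using that e by (auto simp: \<alpha>'_def \<beta>'_def dist_real_def)
        hence "y \<notin> V" using e(2) by force
        hence "y \<in> T N" using sub that V by blast
        thus ?thesis by (auto simp: T_def)
      qed
      ultimately show False using unb by blast
    qed
    ultimately show "openin (top_of_set {\<alpha>..\<beta>}) V \<and> {\<alpha>..\<beta>} \<subseteq> closure V" ..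
  qed auto
  moreover have "\<Inter>(range (\<lambda>N. {\<alpha>..\<beta>} - T N)) = {}"
  proof -
    have "\<exists>N. y \<in> T N" if y: "y \<in> {\<alpha>..\<beta>}" for y
    proof -
      obtain M where M: "\<forall>l. f l y \<le> M" using bounded[OF y] ..
      obtain N where "M \<le> real N" using real_arch_simple by blast
      hence "y \<in> T N" using M y by (auto simp: T_def intro: order_trans)
      thus ?thesis ..
    qed
    thus ?thesis by blast
  qed
  ultimately have "{\<alpha>..\<beta>} \<subseteq> closure {}" by (simp only:)
  thus False using \<open>\<alpha> < \<beta>\<close> by simp
qed

text \<open>
  The right-hand side is the sum of the moduli of all terms obtained by multiplying out.
\<close>

lemma norm_coeff_prod_linear_le:
  fixes t :: "'i \<Rightarrow> 'a::real_normed_field"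
  assumes "finite J"
  shows "norm (coeff (\<Prod>j\<in>J. [:- t j, 1:]) r) \<le> (\<Prod>j\<in>J. 1 + norm (t j))"
  using assms
proof (induction J arbitrary: r rule: finite_induct)
  case empty
  show ?case by (auto simp: coeff_1)
next
  case (insert j J)
  let ?p = "\<Prod>j\<in>J. [:- t j, 1:]" and ?B = "\<Prod>j\<in>J. 1 + norm (t j)"
  have "coeff ([:- t j, 1:] * ?p) r = - t j * coeff ?p r + (if r = 0 then 0 else coeff ?p (r - 1))"
    by (cases r) simp_all
  also have "norm \<dots> \<le> norm (t j) * ?B + ?B"
    using insert.IH[of r] insert.IH[of "r - 1"]
    by (intro norm_triangle_le add_mono)
       (auto simp: norm_mult intro!: mult_left_mono prod_nonneg add_nonneg_nonneg)
  finally show ?case using insert.hyps by (simp add: algebra_simps)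
qed

lemma prod_abs_diff_eq_fact:
  assumes "i \<le> d"
  shows "(\<Prod>j\<in>{..d} - {i}. \<bar>real i - real j\<bar>) = fact i * fact (d - i)"
proof -
  have "{..d} - {i} = {..<i} \<union> {i<..d}" using assms by auto
  hence "(\<Prod>j\<in>{..d} - {i}. \<bar>real i - real j\<bar>) = (\<Prod>j\<in>{..<i} \<union> {i<..d}. \<bar>real i - real j\<bar>)"
    by (rule arg_cong)
  also have "\<dots> = (\<Prod>j<i. \<bar>real i - real j\<bar>) * (\<Prod>j\<in>{i<..d}. \<bar>real i - real j\<bar>)"
    by (rule prod.union_disjoint) auto
  also have "(\<Prod>j<i. \<bar>real i - real j\<bar>) = fact i"
    by (simp add: fact_prod_rev atLeast0LessThan of_nat_diff)
  also have "(\<Prod>j\<in>{i<..d}. \<bar>real i - real j\<bar>) = (\<Prod>j\<in>{1..d - i}. real j)"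
    using assms by (intro prod.reindex_bij_witness[of _ "\<lambda>j. j + i" "\<lambda>j. j - i"]) auto
  also have "\<dots> = fact (d - i)" by (simp add: fact_prod)
  finally show ?thesis .
qed

text \<open>
  The left-hand side divided by \<open>d!\<close> is a single term of the series of \<open>exp d\<close>.
\<close>

lemma power_self_le_exp_fact: "real d ^ d \<le> exp 1 ^ d * fact d"
proof -
  have "real d ^ d /\<^sub>R fact d \<le> (\<Sum>n. real d ^ n /\<^sub>R fact n)"
    using sum_le_suminf[OF summable_exp_generic[of "real d"], of "{d}"] by simp
  also have "\<dots> = exp (real d)" unfolding exp_def ..
  also have "\<dots> = exp 1 ^ d" using exp_of_nat_mult[of d "1 :: real"] by simp
  finally show ?thesis by (simp add: field_simps)
qed

lemma lagrange_interpolation: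
  fixes p :: "'a::field poly" and t :: "nat \<Rightarrow> 'a"
  assumes "degree p \<le> d" "inj_on t {..d}"
  shows "p = (\<Sum>i\<le>d. smult (poly p (t i) / (\<Prod>j\<in>{..d} - {i}. t i - t j)) (\<Prod>j\<in>{..d} - {i}. [:- t j, 1:]))"
    (is "p = ?q")
proof (rule poly_eqI_degree)
  show "poly p x = poly ?q x" if x: "x \<in> t ` {..d}" for x
  proof -
    obtain k where k: "k \<le> d" "x = t k" using x by auto
    have vanish: "(\<Prod>j\<in>{..d} - {i}. t k - t j) = 0" if "i \<noteq> k" for i
      using k that by (intro prod_zero) auto
    have "(\<Prod>j\<in>{..d} - {k}. t k - t j) \<noteq> 0"
      using k assms(2) by (auto simp: inj_on_def)
    moreover have "poly ?q x = (\<Sum>i\<le>d. if i = k then poly p x else 0)"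
      unfolding poly_sum
      by (intro sum.cong refl) (use vanish calculation k in \<open>auto simp: poly_prod\<close>)
    ultimately show ?thesis using k by simp
  qed
  have "degree ?q \<le> d"
  proof (intro degree_sum_le)
    fix i assume "i \<in> {..d}"
    have "degree (\<Prod>j\<in>{..d} - {i}. [:- t j, 1:]) \<le> sum (\<lambda>j. degree [:- t j, 1:]) ({..d} - {i})"
      by (rule order_trans[OF degree_prod_sum_le]) (auto simp: o_def)
    also have "\<dots> = d" using \<open>i \<in> {..d}\<close> by simp
    finally show "degree (smult (poly p (t i) / (\<Prod>j\<in>{..d} - {i}. t i - t j)) (\<Prod>j\<in>{..d} - {i}. [:- t j, 1:])) \<le> d"
      by (intro order_trans[OF degree_smult_le])
  qed auto
  thus "degree ?q < card (t ` {..d})" "degree p < card (t ` {..d})"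
    using assms by (simp_all add: card_image)
qed

text \<open>
  Interpolation at \<open>d + 1\<close> equidistant nodes of spacing \<open>L / d\<close>, where \<open>L\<close> is the length of the
  interval. The denominators are \<open>(L / d) ^ d * i! * (d - i)!\<close>, and since \<open>d!\<close> is at most
  \<open>2 ^ d * i! * (d - i)!\<close> and at least \<open>(d / e) ^ d\<close>, they are at least \<open>(L / (2 * e)) ^ d\<close>. So every
  Lagrange basis polynomial has coefficients that are at most geometric in \<open>d\<close>.
\<close>

lemma coeff_bound_of_bounded_on_interval:
  assumes "\<alpha> < \<beta>"
  shows "\<exists>K\<ge>1. \<forall>d M r (p :: 'a::real_normed_field poly). degree p \<le> d \<longrightarrow>
    (\<forall>y\<in>{\<alpha>..\<beta>}. norm (poly p (of_real y)) \<le> M) \<longrightarrow> norm (coeff p r) \<le> M * K ^ d"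
proof -
  define Y where "Y = \<bar>\<alpha>\<bar> + \<bar>\<beta>\<bar>"
  define L where "L = \<beta> - \<alpha>"
  \<comment> \<open>The first 2 absorbs the d + 1 summands, 2 * exp 1 / L the denominators, 1 + Y the numerators.\<close>
  define K where "K = max 1 (2 * (2 * exp 1 * (1 + Y) / L))"
  have "L > 0" "Y \<ge> 0" using assms by (auto simp: L_def Y_def)
  have "norm (coeff p r) \<le> M * K ^ d"
    if deg: "degree p \<le> d" and bd: "\<And>y. y \<in> {\<alpha>..\<beta>} \<Longrightarrow> norm (poly p (of_real y)) \<le> M"
    for d M r and p :: "'a poly"
  proof (cases "d = 0")
    case True
    obtain c where c: "p = [:c:]" by (rule degree_eq_zeroE[of p]) (use deg True in simp)
    have "norm c \<le> M" using bd[of \<alpha>] assms c by simp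
    moreover from this have "0 \<le> M" by (rule order_trans[OF norm_ge_zero])
    ultimately show ?thesis using True c by (cases r) simp_all
  next
    case False
    define h where "h = L / d"
    have "h > 0" using False \<open>L > 0\<close> by (simp add: h_def)
    define t where "t j = \<alpha> + h * real j" for j
    have t_in: "t j \<in> {\<alpha>..\<beta>}" if "j \<le> d" for j
    proof -
      have "h * real j \<le> h * real d" using that \<open>h > 0\<close> by simp
      also have "\<dots> = L" using False by (simp add: h_def)
      finally show ?thesis using \<open>h > 0\<close> by (auto simp: t_def L_def)
    qed
    have t_bd: "norm (of_real (t j) :: 'a) \<le> Y" if "j \<le> d" for j
      using t_in[OF that] by (auto simp: Y_def)
    have "M \<ge> 0" using order_trans[OF norm_ge_zero bd[of \<alpha>]] assms by simp
    define c where "c i = poly p (of_real (t i)) / (\<Prod>j\<in>{..d} - {i}. of_real (t i) - of_real (t j))" for i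
    have c_bd: "norm (c i) \<le> M * (2 * exp 1 / L) ^ d" if "i \<le> d" for i
    proof -
      have "norm (\<Prod>j\<in>{..d} - {i}. of_real (t i) - of_real (t j) :: 'a) = (\<Prod>j\<in>{..d} - {i}. h * \<bar>real i - real j\<bar>)"
        unfolding prod_norm[symmetric]
      proof (intro prod.cong refl)
        fix j
        have "norm (of_real (t i) - of_real (t j) :: 'a) = \<bar>t i - t j\<bar>"
          by (metis norm_of_real of_real_diff)
        also have "t i - t j = h * (real i - real j)" by (simp add: t_def algebra_simps)
        finally show "norm (of_real (t i) - of_real (t j) :: 'a) = h * \<bar>real i - real j\<bar>"
          using \<open>h > 0\<close> by (simp add: abs_mult)
      qed
      also have "\<dots> = h ^ d * (fact i * fact (d - i))"
        using that by (simp add: prod.distrib prod_abs_diff_eq_fact)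
      finally have den: "norm (\<Prod>j\<in>{..d} - {i}. of_real (t i) - of_real (t j) :: 'a) = h ^ d * (fact i * fact (d - i))" .
      have "real d ^ d \<le> exp 1 ^ d * fact d" by (rule power_self_le_exp_fact)
      also have "\<dots> = exp 1 ^ d * ((fact i * fact (d - i)) * real (d choose i))"
        using binomial_fact_lemma[OF that] by (metis of_nat_fact of_nat_mult)
      also have "\<dots> \<le> exp 1 ^ d * ((fact i * fact (d - i)) * 2 ^ d)"
        using binomial_le_pow2[of d i] by (intro mult_left_mono) (simp_all flip: of_nat_le_iff)
      also have "\<dots> = (2 * exp 1) ^ d * (fact i * fact (d - i))"
        by (simp only: power_mult_distrib mult_ac)
      finally have "real d ^ d \<le> (2 * exp 1) ^ d * (fact i * fact (d - i))" .
      hence "L ^ d \<le> (2 * exp 1) ^ d * (h ^ d * (fact i * fact (d - i)))"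
        using False \<open>L > 0\<close> by (simp add: h_def power_divide field_simps)
      hence "1 / (h ^ d * (fact i * fact (d - i))) \<le> (2 * exp 1 / L) ^ d"
        using \<open>L > 0\<close> \<open>h > 0\<close> by (simp add: power_divide field_simps)
      hence "M * (1 / (h ^ d * (fact i * fact (d - i)))) \<le> M * (2 * exp 1 / L) ^ d"
        using \<open>M \<ge> 0\<close> by (intro mult_left_mono)
      moreover have "norm (c i) \<le> M / (h ^ d * (fact i * fact (d - i)))"
        unfolding c_def norm_divide den using bd[OF t_in[OF that]] \<open>h > 0\<close>
        by (intro divide_right_mono) auto
      ultimately show ?thesis by simp
    qed
    have "inj_on (\<lambda>i. of_real (t i) :: 'a) {..d}"
      using \<open>h > 0\<close> by (auto simp: inj_on_def t_def)
    hence "p = (\<Sum>i\<le>d. smult (c i) (\<Prod>j\<in>{..d} - {i}. [:- of_real (t j), 1:]))"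
      unfolding c_def by (rule lagrange_interpolation[OF deg])
    hence "coeff p r = coeff (\<Sum>i\<le>d. smult (c i) (\<Prod>j\<in>{..d} - {i}. [:- of_real (t j), 1:])) r"
      by (rule arg_cong)
    also have "\<dots> = (\<Sum>i\<le>d. c i * coeff (\<Prod>j\<in>{..d} - {i}. [:- of_real (t j), 1:]) r)"
      by (simp only: coeff_sum coeff_smult)
    finally have "norm (coeff p r) \<le> norm (\<Sum>i\<le>d. c i * coeff (\<Prod>j\<in>{..d} - {i}. [:- of_real (t j), 1:]) r)"
      by (simp only: order_refl)
    also have "\<dots> \<le> (\<Sum>i\<le>d. (M * (2 * exp 1 / L) ^ d) * (1 + Y) ^ d)"
    proof (intro sum_norm_le)
      fix i assume i: "i \<in> {..d}"
      have "norm (coeff (\<Prod>j\<in>{..d} - {i}. [:- of_real (t j) :: 'a, 1:]) r) \<le> (\<Prod>j\<in>{..d} - {i}. 1 + norm (of_real (t j) :: 'a))"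
        by (rule norm_coeff_prod_linear_le) simp
      also have "\<dots> \<le> (\<Prod>j\<in>{..d} - {i}. 1 + Y)"
        using t_bd by (intro prod_mono) auto
      also have "\<dots> = (1 + Y) ^ d" using i by simp
      finally show "norm (c i * coeff (\<Prod>j\<in>{..d} - {i}. [:- of_real (t j), 1:]) r)
          \<le> (M * (2 * exp 1 / L) ^ d) * (1 + Y) ^ d"
        unfolding norm_mult using c_bd[of i] i \<open>M \<ge> 0\<close> \<open>L > 0\<close>
        by (intro mult_mono) auto
    qed
    also have "\<dots> = real (Suc d) * (M * (2 * exp 1 * (1 + Y) / L) ^ d)"
      by (simp add: power_mult_distrib power_divide)
    also have "\<dots> \<le> 2 ^ d * (M * (2 * exp 1 * (1 + Y) / L) ^ d)"
    proof (intro mult_right_mono)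
      have "Suc d \<le> 2 ^ d" by (simp add: Suc_leI)
      thus "real (Suc d) \<le> 2 ^ d" by (metis of_nat_le_iff of_nat_numeral of_nat_power)
    qed (use \<open>M \<ge> 0\<close> \<open>L > 0\<close> \<open>Y \<ge> 0\<close> in simp)
    also have "\<dots> = M * (2 * (2 * exp 1 * (1 + Y) / L)) ^ d"
      by (simp only: power_mult_distrib mult_ac)
    also have "\<dots> \<le> M * K ^ d"
      using \<open>M \<ge> 0\<close> \<open>L > 0\<close> \<open>Y \<ge> 0\<close> by (intro mult_left_mono power_mono) (auto simp: K_def)
    finally show ?thesis .
  qed
  thus ?thesis by (intro exI[of _ K]) (auto simp: K_def)
qed

section \<open>Growth of the terms of the expansion\<close>

text \<open>
  In a homogeneous polynomial of degree \<open>d\<close> the exponent \<open>r\<close> of \<open>z\<^sub>2\<close> determines that of \<open>z\<^sub>1\<close>.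
\<close>

lemma eval2_homogeneous:
  fixes p :: "'a::comm_ring_1 poly poly"
  assumes hom: "homogeneous2 (int d) p"
  shows "eval2 p x y = (\<Sum>r\<le>d. coeff (coeff p r) (d - r) * x ^ (d - r) * y ^ r)"
proof -
  have zero: "coeff (coeff p r) q = 0" if "q + r \<noteq> d" for q r
    using hom that unfolding homogeneous2_def by (metis of_nat_add of_nat_eq_iff)
  have "coeff p r = monom (coeff (coeff p r) (d - r)) (d - r)" if "r \<le> d" for r
    by (rule poly_eqI) (use zero that in \<open>auto simp: coeff_monom\<close>)
  hence eval: "poly (coeff p r) x = coeff (coeff p r) (d - r) * x ^ (d - r)" if "r \<le> d" for r
    using that poly_monom by metis
  have "coeff p r = 0" if "r > d" for r
    by (rule poly_eqI) (use zero that in auto)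
  hence "degree p \<le> d" by (intro degree_le) auto
  hence "poly p [:y:] = (\<Sum>r\<le>d. coeff p r * [:y:] ^ r)"
    unfolding poly_altdef by (intro sum.mono_neutral_left) (auto simp: coeff_eq_0)
  hence "eval2 p x y = (\<Sum>r\<le>d. poly (coeff p r) x * y ^ r)"
    by (simp add: eval2_def poly_sum poly_power)
  also have "\<dots> = (\<Sum>r\<le>d. coeff (coeff p r) (d - r) * x ^ (d - r) * y ^ r)"
    by (intro sum.cong refl) (simp add: eval)
  finally show ?thesis .
qed

text \<open>
  The function \<open>W\<close> stands for \<open>1 / R\<close>. There are \<open>d + 1 \<le> 2 ^ d\<close> monomials, each a product of
  \<open>e + d\<close> factors and a constant.
\<close>

lemma derivs_bounded_homogeneous:
  fixes W :: "real^2 \<Rightarrow> 'a::real_normed_field"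
  assumes W: "derivs_bounded k U (-1) B W" and "1 \<le> B" "0 \<notin> U"
    and c: "\<And>r. r \<le> d \<Longrightarrow> norm (c r) \<le> M"
  shows "derivs_bounded k U (int d - int e) (8 ^ k * M * (2 * 2 ^ k * B) ^ (e + d))
    (\<lambda>z. W z ^ e * (\<Sum>r\<le>d. c r * of_real (z$1) ^ (d - r) * of_real (z$2) ^ r))"
proof -
  have "M \<ge> 0" using order_trans[OF norm_ge_zero c[of 0]] by simp
  have power: "derivs_bounded k U (int n) ((2 ^ k) ^ n) (\<lambda>z. of_real (z $ j) ^ n :: 'a)" for n j
    using derivs_bounded_power[OF derivs_bounded_coordinate] \<open>0 \<notin> U\<close> by fastforce
  have mono: "derivs_bounded k U (int d) (4 ^ k * M * (2 ^ k) ^ d)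
      (\<lambda>z. c r * of_real (z$1) ^ (d - r) * of_real (z$2) ^ r)" if "r \<le> d" for r
  proof -
    have bd: "derivs_bounded k U (0 + int (d - r) + int r)
        (2 ^ k * (2 ^ k * norm (c r) * (2 ^ k) ^ (d - r)) * (2 ^ k) ^ r)
        (\<lambda>z. c r * of_real (z$1) ^ (d - r) * of_real (z$2) ^ r)"
      by (intro derivs_bounded_mult derivs_bounded_const power) (use \<open>0 \<notin> U\<close> in auto)
    have const: "2 ^ k * (2 ^ k * norm (c r) * (2 ^ k) ^ (d - r)) * (2 ^ k) ^ r =
        4 ^ k * norm (c r) * (2 ^ k) ^ d"
    proof -
      have "(2 ^ k) ^ d = ((2 ^ k) ^ (d - r) * (2 ^ k) ^ r :: real)"
        using that by (simp flip: power_add)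
      moreover have "(4::real) ^ k = 2 ^ k * 2 ^ k" by (simp flip: power_mult_distrib)
      ultimately show ?thesis by simp
    qed
    have le: "4 ^ k * norm (c r) * (2 ^ k) ^ d \<le> 4 ^ k * M * (2 ^ k) ^ d"
      using c[OF that] by (intro mult_right_mono mult_left_mono) auto
    have exponent: "0 + int (d - r) + int r = int d" using that by simp
    show ?thesis using derivs_bounded_mono[OF bd[unfolded exponent const] le] .
  qed
  have "derivs_bounded k U (int d) (\<Sum>r\<le>d. 4 ^ k * M * (2 ^ k) ^ d)
      (\<lambda>z. \<Sum>r\<le>d. c r * of_real (z$1) ^ (d - r) * of_real (z$2) ^ r)"
    by (rule derivs_bounded_sum) (use mono in auto)
  hence bd: "derivs_bounded k U (int e * - 1 + int d)
      (2 ^ k * (2 ^ k * B) ^ e * (\<Sum>r\<le>d. 4 ^ k * M * (2 ^ k) ^ d))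
      (\<lambda>z. W z ^ e * (\<Sum>r\<le>d. c r * of_real (z$1) ^ (d - r) * of_real (z$2) ^ r))"
    by (intro derivs_bounded_mult derivs_bounded_power W)
       (use assms \<open>M \<ge> 0\<close> in \<open>auto intro!: sum_nonneg\<close>)
  have exponent: "int e * - 1 + int d = int d - int e" by simp
  have le: "2 ^ k * (2 ^ k * B) ^ e * (\<Sum>r\<le>d. 4 ^ k * M * (2 ^ k) ^ d)
      \<le> 8 ^ k * M * (2 * 2 ^ k * B) ^ (e + d)"
  proof -
    have "Suc d \<le> 2 ^ d" by (simp add: Suc_leI)
    hence "real (Suc d) \<le> 2 ^ d" by (metis of_nat_le_iff of_nat_numeral of_nat_power)
    hence "real (Suc d) * (2 ^ k) ^ d \<le> 2 ^ d * (2 ^ k) ^ d"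
      by (intro mult_right_mono) auto
    also have "\<dots> = (2 * 2 ^ k) ^ d" by (simp only: power_mult_distrib)
    also have "\<dots> \<le> (2 * 2 ^ k * B) ^ d"
      using \<open>1 \<le> B\<close> by (intro power_mono) auto
    finally have 1: "real (Suc d) * (2 ^ k) ^ d \<le> (2 * 2 ^ k * B) ^ d" .
    have 2: "(2 ^ k * B) ^ e \<le> (2 * 2 ^ k * B) ^ e"
      using \<open>1 \<le> B\<close> by (intro power_mono) auto
    have "(2 ^ k * B) ^ e * (real (Suc d) * (2 ^ k) ^ d) \<le> (2 * 2 ^ k * B) ^ e * (2 * 2 ^ k * B) ^ d"
      using 1 2 \<open>1 \<le> B\<close> by (intro mult_mono) auto
    hence "(2 ^ k * 4 ^ k * M) * ((2 ^ k * B) ^ e * (real (Suc d) * (2 ^ k) ^ d))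
        \<le> (2 ^ k * 4 ^ k * M) * (2 * 2 ^ k * B) ^ (e + d)"
      using \<open>M \<ge> 0\<close> unfolding power_add by (intro mult_left_mono) auto
    moreover have "2 ^ k * 4 ^ k = (8::real) ^ k" by (simp flip: power_mult_distrib)
    moreover have "2 ^ k * (2 ^ k * B) ^ e * (\<Sum>r\<le>d. 4 ^ k * M * (2 ^ k) ^ d) =
        (2 ^ k * 4 ^ k * M) * ((2 ^ k * B) ^ e * (real (Suc d) * (2 ^ k) ^ d))"
      by simp
    ultimately show ?thesis by (simp only:)
  qed
  show ?thesis using derivs_bounded_mono[OF bd[unfolded exponent] le] .
qed

text \<open>
  Here \<open>\<omega> y\<close> is the value of \<open>R\<close> at the point of a fixed vertical segment with \<open>z\<^sub>2 = y\<close>. Pointwise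
  bounds become uniform on a subsegment, where the powers of \<open>\<omega>\<close> can be replaced by powers of its
  maximum; this leaves polynomials in \<open>y\<close> alone.
\<close>

lemma coeff_growth_of_bounded_terms:
  fixes c :: "nat \<Rightarrow> nat \<Rightarrow> 'a::real_normed_field" and \<omega> :: "real \<Rightarrow> real"
  assumes "\<alpha> < \<beta>" and cont: "continuous_on {\<alpha>..\<beta>} \<omega>" and pos: "\<And>y. y \<in> {\<alpha>..\<beta>} \<Longrightarrow> \<omega> y > 0"
    and bounded: "\<And>y. y \<in> {\<alpha>..\<beta>} \<Longrightarrow>
      \<exists>M. \<forall>l. norm (\<Sum>r\<le>d l. c l r * of_real y ^ r) / \<omega> y ^ e l \<le> M"
  shows "\<exists>M\<ge>0. \<exists>A\<ge>1. \<forall>l r. r \<le> d l \<longrightarrow> norm (c l r) \<le> M * A ^ (e l + d l)"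
proof -
  have "\<exists>\<alpha>' \<beta>' M. \<alpha>' < \<beta>' \<and> {\<alpha>'..\<beta>'} \<subseteq> {\<alpha>..\<beta>} \<and>
      (\<forall>l. \<forall>y\<in>{\<alpha>'..\<beta>'}. norm (\<Sum>r\<le>d l. c l r * of_real y ^ r) / \<omega> y ^ e l \<le> M)"
    by (rule bounded_on_subinterval[OF \<open>\<alpha> < \<beta>\<close>])
       (use pos bounded in \<open>force intro!: continuous_intros cont\<close>)+
  then obtain \<alpha>' \<beta>' M where sub: "\<alpha>' < \<beta>'" "{\<alpha>'..\<beta>'} \<subseteq> {\<alpha>..\<beta>}" and
    M: "\<And>l y. y \<in> {\<alpha>'..\<beta>'} \<Longrightarrow> norm (\<Sum>r\<le>d l. c l r * of_real y ^ r) / \<omega> y ^ e l \<le> M"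
    by blast
  have "0 \<le> norm (\<Sum>r\<le>d 0. c 0 r * of_real \<alpha>' ^ r) / \<omega> \<alpha>' ^ e 0"
    using pos[of \<alpha>'] sub by (intro divide_nonneg_nonneg zero_le_power) (auto intro: less_imp_le)
  also have "\<dots> \<le> M" using sub by (intro M) auto
  finally have "M \<ge> 0" .
  have "bdd_above (\<omega> ` {\<alpha>..\<beta>})"
    by (intro bounded_imp_bdd_above compact_imp_bounded compact_continuous_image cont) auto
  then obtain \<Omega> where "\<forall>x\<in>\<omega> ` {\<alpha>..\<beta>}. x \<le> \<Omega>" unfolding bdd_above_def ..
  hence \<Omega>: "\<omega> y \<le> \<Omega>" if "y \<in> {\<alpha>..\<beta>}" for y using that by blast
  obtain K where "K \<ge> 1" and K: "\<And>d M r (p :: 'a poly). degree p \<le> d \<Longrightarrow>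
      (\<And>y. y \<in> {\<alpha>'..\<beta>'} \<Longrightarrow> norm (poly p (of_real y)) \<le> M) \<Longrightarrow> norm (coeff p r) \<le> M * K ^ d"
    using coeff_bound_of_bounded_on_interval[OF sub(1), where 'a = 'a] by metis
  define A where "A = max K \<Omega>"
  have "norm (c l r) \<le> M * A ^ (e l + d l)" if "r \<le> d l" for l r
  proof -
    define p where "p = (\<Sum>r\<le>d l. monom (c l r) r)"
    have "degree p \<le> d l"
      unfolding p_def by (intro degree_sum_le) (auto intro: order_trans[OF degree_monom_le])
    moreover have "norm (poly p (of_real y)) \<le> M * A ^ e l" if "y \<in> {\<alpha>'..\<beta>'}" for y
    proof -
      have y: "\<omega> y > 0" "\<omega> y \<le> A" using pos[of y] \<Omega>[of y] that sub by (auto simp: A_def)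
      have "norm (poly p (of_real y)) \<le> M * \<omega> y ^ e l"
        using M[OF that, of l] y by (simp add: p_def poly_sum poly_monom divide_le_eq)
      also have "\<dots> \<le> M * A ^ e l"
        using y \<open>M \<ge> 0\<close> by (intro mult_left_mono power_mono) auto
      finally show ?thesis .
    qed
    ultimately have "norm (coeff p r) \<le> (M * A ^ e l) * K ^ d l" by (rule K)
    also have "\<dots> \<le> (M * A ^ e l) * A ^ d l"
      using \<open>K \<ge> 1\<close> \<open>M \<ge> 0\<close> by (intro mult_left_mono power_mono) (auto simp: A_def)
    also have "coeff p r = c l r"
      using that by (simp add: p_def coeff_sum)
    finally show ?thesis by (simp add: power_add mult_ac)
  qed
  thus ?thesis using \<open>M \<ge> 0\<close> \<open>K \<ge> 1\<close> by (intro exI[of _ M] conjI exI[of _ A]) (auto simp: A_def)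
qed

lemma kernel_term_eq:
  fixes P :: "nat \<Rightarrow> 'a::real_normed_field poly poly"
  assumes "homogeneous2 (int d) (P l)" "R_exponent m\<^sub>1 l = - int e"
  shows "kernel_term a b c m\<^sub>1 P l z = of_real (inverse (R a b c z)) ^ e *
    (\<Sum>r\<le>d. coeff (coeff (P l) r) (d - r) * of_real (z$1) ^ (d - r) * of_real (z$2) ^ r)"
  by (simp add: kernel_term_def eval2_homogeneous[OF assms(1)] assms(2) power_int_minus power_inverse)

text \<open>
  Terms of a convergent series are bounded. Convergence is only used on a segment of the line
  \<open>z\<^sub>1 = \<epsilon> / 2\<close>, where \<open>P l\<close> becomes a polynomial in \<open>z\<^sub>2\<close> whose coefficients are those of \<open>P l\<close> times powers of
  \<open>\<epsilon> / 2\<close>; dividing by these powers costs another geometric factor.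
\<close>

lemma kernel_coeff_growth:
  fixes P :: "nat \<Rightarrow> 'a::real_normed_field poly poly"
  assumes "a > 0" "c > 0" "4 * a * c - b\<^sup>2 > 0" "\<epsilon> > 0"
    and hom: "\<And>l. homogeneous2 (int (d l)) (P (Suc l))"
    and e: "\<And>l. R_exponent m\<^sub>1 (Suc l) = - int (e l)"
    and summable: "\<And>z. z \<in> punctured_disk \<epsilon> \<Longrightarrow> summable (\<lambda>l. kernel_term a b c m\<^sub>1 P (Suc l) z)"
  shows "\<exists>M\<ge>0. \<exists>A\<ge>1. \<forall>l r. r \<le> d l \<longrightarrow>
    norm (coeff (coeff (P (Suc l)) r) (d l - r)) \<le> M * A ^ (e l + d l)"
proof -
  define x where "x = \<epsilon> / 2"
  define \<phi> :: "real \<Rightarrow> real^2" where "\<phi> y = (\<chi> i. if i = 1 then x else y)" for y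
  have \<phi>: "\<phi> y $ 1 = x" "\<phi> y $ 2 = y" for y by (simp_all add: \<phi>_def)
  have "x > 0" using \<open>\<epsilon> > 0\<close> by (simp add: x_def)
  have \<phi>_in: "\<phi> y \<in> punctured_disk \<epsilon>" if "y \<in> {0..x}" for y
  proof -
    have "norm (\<phi> y) \<le> \<bar>x\<bar> + \<bar>y\<bar>"
      using norm_le_l1_cart[of "\<phi> y"] by (simp add: sum_2 \<phi>)
    also have "\<dots> \<le> \<epsilon>" using that \<open>x > 0\<close> by (simp add: x_def)
    finally show ?thesis
      using \<open>x > 0\<close> \<phi>(1)[of y] by (auto simp: punctured_disk_def)
  qed
  obtain \<kappa> where \<kappa>: "\<kappa> > 0" "\<And>z. \<kappa> * norm z \<le> R a b c z"
    using R_lower_bound assms(1-3) by blast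
  have pos: "R a b c (\<phi> y) > 0" if "y \<in> {0..x}" for y
  proof -
    have "0 < \<kappa> * norm (\<phi> y)"
      using \<kappa>(1) \<phi>_in[OF that] by (simp add: punctured_disk_def)
    thus ?thesis using \<kappa>(2) by (rule order_less_le_trans)
  qed
  define C where "C l r = coeff (coeff (P (Suc l)) r) (d l - r) * of_real x ^ (d l - r)" for l r
  have norm_term: "norm (\<Sum>r\<le>d l. C l r * of_real y ^ r) / R a b c (\<phi> y) ^ e l =
      norm (kernel_term a b c m\<^sub>1 P (Suc l) (\<phi> y))" if "y \<in> {0..x}" for l y
    using pos[OF that] unfolding kernel_term_eq[where P = P and l = "Suc l", OF hom[of l] e[of l]]
    by (simp add: norm_mult norm_power norm_inverse C_def \<phi> divide_inverse power_inverse mult.commute)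
  have "\<exists>M\<ge>0. \<exists>A\<ge>1. \<forall>l r. r \<le> d l \<longrightarrow> norm (C l r) \<le> M * A ^ (e l + d l)"
  proof (rule coeff_growth_of_bounded_terms)
    show "continuous_on {0..x} (\<lambda>y. R a b c (\<phi> y))"
      unfolding R_def \<phi> by (intro continuous_intros)
    show "\<exists>M. \<forall>l. norm (\<Sum>r\<le>d l. C l r * of_real y ^ r) / R a b c (\<phi> y) ^ e l \<le> M"
      if "y \<in> {0..x}" for y
    proof -
      have "Bseq (\<lambda>l. kernel_term a b c m\<^sub>1 P (Suc l) (\<phi> y))"
        by (rule convergent_imp_Bseq) (use summable_LIMSEQ_zero[OF summable[OF \<phi>_in[OF that]]] in \<open>auto simp: convergent_def\<close>)
      thus ?thesis unfolding norm_term[OF that] Bseq_def by blast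
    qed
  qed (use \<open>x > 0\<close> pos in auto)
  then obtain M A where MA: "M \<ge> 0" "A \<ge> 1" "\<And>l r. r \<le> d l \<Longrightarrow> norm (C l r) \<le> M * A ^ (e l + d l)"
    by blast
  define X where "X = max 1 (1 / x)"
  have "norm (coeff (coeff (P (Suc l)) r) (d l - r)) \<le> M * (A * X) ^ (e l + d l)" if "r \<le> d l" for l r
  proof -
    have "norm (coeff (coeff (P (Suc l)) r) (d l - r)) = norm (C l r) * (1 / x) ^ (d l - r)"
      using \<open>x > 0\<close> by (simp add: C_def norm_mult norm_power power_divide)
    also have "\<dots> \<le> (M * A ^ (e l + d l)) * X ^ (e l + d l)"
    proof (intro mult_mono MA that)
      have "(1 / x) ^ (d l - r) \<le> X ^ (d l - r)"
        using \<open>x > 0\<close> by (intro power_mono) (auto simp: X_def)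
      also have "\<dots> \<le> X ^ (e l + d l)" by (intro power_increasing) (auto simp: X_def)
      finally show "(1 / x) ^ (d l - r) \<le> X ^ (e l + d l)" .
    qed (use MA \<open>x > 0\<close> in auto)
    finally show ?thesis by (simp add: power_mult_distrib mult_ac)
  qed
  moreover have "A * X \<ge> 1" using MA(2) mult_mono[of 1 A 1 X] by (auto simp: X_def)
  ultimately show ?thesis using MA(1) by (intro exI[of _ M] conjI exI[of _ "A * X"]) auto
qed

text \<open>
  The degree of \<open>P l\<close> and the exponent of \<open>1 / R\<close> are both affine in \<open>l\<close>, so all the constants collected
  above combine into one geometric sequence. The difference of the two is the degree of homogeneity of
  the term. The index is shifted because the expansion starts at \<open>l = 1\<close>.
\<close>

lemma kernel_terms_derivs_bounded:
  fixes P :: "nat \<Rightarrow> 'a::real_normed_field poly poly"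
  assumes "a > 0" "c > 0" "4 * a * c - b\<^sup>2 > 0" "m\<^sub>1 \<ge> 0" "m\<^sub>2 \<ge> -3" "\<epsilon> > 0" "0 \<notin> U"
    and hom: "\<And>l. l \<ge> 1 \<Longrightarrow> homogeneous2 (3 * int l + m\<^sub>2) (P l)"
    and summable: "\<And>z. z \<in> punctured_disk \<epsilon> \<Longrightarrow> summable (\<lambda>l. kernel_term a b c m\<^sub>1 P (Suc l) z)"
  shows "\<exists>M\<ge>0. \<exists>C\<ge>1. \<forall>l. derivs_bounded k U (- 2 * m\<^sub>1 + m\<^sub>2 + 2 + int l) (M * C ^ l)
    (kernel_term a b c m\<^sub>1 P (Suc l))"
proof -
  define d where "d l = nat (3 * int (Suc l) + m\<^sub>2)" for l
  define e where "e l = nat (2 * (int (Suc l) + m\<^sub>1) - 1)" for l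
  \<comment> \<open>The total number of factors is affine in l with slope 5.\<close>
  define q where "q = nat (2 * m\<^sub>1 + m\<^sub>2 + 4)"
  have d: "int (d l) = 3 * int (Suc l) + m\<^sub>2" for l using assms by (simp add: d_def)
  have e: "int (e l) = 2 * (int (Suc l) + m\<^sub>1) - 1" for l using assms by (simp add: e_def)
  have q: "e l + d l = q + 5 * l" for l
    using d[of l] e[of l] assms by (simp add: q_def)
  have hom': "homogeneous2 (int (d l)) (P (Suc l))" for l using hom[of "Suc l"] d by simp
  have e': "R_exponent m\<^sub>1 (Suc l) = - int (e l)" for l using e by (simp add: R_exponent_def)
  obtain M A where MA: "M \<ge> 0" "A \<ge> 1" "\<And>l r. r \<le> d l \<Longrightarrow>
      norm (coeff (coeff (P (Suc l)) r) (d l - r)) \<le> M * A ^ (e l + d l)"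
    using kernel_coeff_growth[where P = P and d = d and e = e, OF assms(1-3) \<open>\<epsilon> > 0\<close> hom' e' summable] by blast
  obtain B0 where "derivs_bounded k U (-1) B0 (\<lambda>z. of_real (inverse (R a b c z)) :: 'a)"
    using derivs_bounded_inverse_R assms(1-3,7) by blast
  hence B: "derivs_bounded k U (-1) (max 1 B0) (\<lambda>z. of_real (inverse (R a b c z)) :: 'a)"
    by (rule derivs_bounded_mono) simp
  define Q where "Q = A * (2 * 2 ^ k * max 1 B0)"
  have "1 \<le> 2 * 2 ^ k * max 1 B0"
    using mult_mono[of 1 "2 ^ Suc k" 1 "max 1 B0"] one_le_power[of "2::real" "Suc k"] by simp
  hence "Q \<ge> 1" using MA(2) mult_mono[of 1 A 1 "2 * 2 ^ k * max 1 B0"] by (simp add: Q_def)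
  have "derivs_bounded k U (- 2 * m\<^sub>1 + m\<^sub>2 + 2 + int l) ((8 ^ k * M * Q ^ q) * (Q ^ 5) ^ l)
      (kernel_term a b c m\<^sub>1 P (Suc l))" for l
  proof -
    have "derivs_bounded k U (int (d l) - int (e l))
        (8 ^ k * (M * A ^ (e l + d l)) * (2 * 2 ^ k * max 1 B0) ^ (e l + d l))
        (kernel_term a b c m\<^sub>1 P (Suc l))"
      unfolding kernel_term_eq[where P = P and l = "Suc l", OF hom'[of l] e'[of l], abs_def]
      by (rule derivs_bounded_homogeneous[OF B _ \<open>0 \<notin> U\<close> MA(3)]) auto
    moreover have "int (d l) - int (e l) = - 2 * m\<^sub>1 + m\<^sub>2 + 2 + int l"
      by (simp add: d e)
    moreover have "8 ^ k * (M * A ^ (e l + d l)) * (2 * 2 ^ k * max 1 B0) ^ (e l + d l) =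
        (8 ^ k * M) * Q ^ (e l + d l)"
      unfolding Q_def by (simp only: power_mult_distrib mult_ac)
    moreover have "\<dots> = (8 ^ k * M * Q ^ q) * (Q ^ 5) ^ l"
      by (simp only: q power_add power_mult mult.assoc)
    ultimately show ?thesis by (simp only:)
  qed
  thus ?thesis using MA(1) \<open>Q \<ge> 1\<close>
    by (intro exI[of _ "8 ^ k * M * Q ^ q"] conjI exI[of _ "Q ^ 5"]) auto
qed

section \<open>Regularity of the remainder\<close>

theorem theorem3:
  fixes K :: "real^2 \<Rightarrow> 'a::{real_normed_field, banach}"
    and P :: "nat \<Rightarrow> 'a poly poly"
    and a b c \<epsilon> :: real
    and m m\<^sub>1 m\<^sub>2 :: int
    and n :: nat
  assumes "a > 0" and "c > 0" and "4 * a * c - b^2 > 0"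
    and "m\<^sub>1 \<ge> 0" and "m\<^sub>2 \<ge> -3" and "n > 0"
    and "\<epsilon> > 0"
    and "\<And>l. l \<ge> 1 \<Longrightarrow> homogeneous2 (3 * int l + m\<^sub>2) (P l)"
    and "\<And>z. z \<in> punctured_disk \<epsilon> \<Longrightarrow> (\<lambda>l. kernel_term a b c m\<^sub>1 P (Suc l) z) sums K z"
    and "m = kernel_zeta m\<^sub>1 P" and "m = -2 * m\<^sub>1 + m\<^sub>2 + 2" and "m < 0"
    and "m + int n \<ge> 1"
    and "\<And>z. z \<in> punctured_disk \<epsilon> \<Longrightarrow> Ck_at (nat (m + int n - 1)) K z"
  defines "\<rho> \<equiv> extend_at_0 (\<lambda>z. K z - kernel_trunc a b c m\<^sub>1 P n z)"
  shows "Ck_at (nat (m + int n - 1)) \<rho> 0 \<and>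
    (\<forall>\<alpha>. int (fst \<alpha> + snd \<alpha>) \<le> m + int n - 1 \<longrightarrow> multi_deriv \<alpha> \<rho> 0 = 0)"
proof -
  define k where "k = nat (m + int n - 1)"
  have k: "int k = m + int n - 1" using assms(13) by (simp add: k_def)
  define g where "g z = K z - kernel_trunc a b c m\<^sub>1 P n z" for z
  have "\<exists>M\<ge>0. \<exists>C\<ge>1. \<forall>l. derivs_bounded k (- {0}) (- 2 * m\<^sub>1 + m\<^sub>2 + 2 + int l) (M * C ^ l)
      (kernel_term a b c m\<^sub>1 P (Suc l))"
    by (rule kernel_terms_derivs_bounded[OF assms(1-5,7)]) (use assms(8,9) in \<open>auto simp: sums_iff\<close>)
  then obtain M C where MC: "M \<ge> 0" "C \<ge> 1"
    "\<And>l. derivs_bounded k (- {0}) (m + int l) (M * C ^ l) (kernel_term a b c m\<^sub>1 P (Suc l))"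
    unfolding assms(11) by blast
  \<comment> \<open>Small enough for the disk of convergence, for a ratio of at most one half, and for powers of the distance to be decreasing in the exponent.\<close>
  define \<delta> where "\<delta> = min 1 (min \<epsilon> (1 / (2 * C)))"
  have \<delta>: "\<delta> > 0" "\<delta> \<le> 1" "\<delta> \<le> \<epsilon>" using MC(2) \<open>\<epsilon> > 0\<close> by (auto simp: \<delta>_def)
  have "C * \<delta> \<le> C * (1 / (2 * C))" using MC(2) by (intro mult_left_mono) (auto simp: \<delta>_def)
  hence C\<delta>: "C * \<delta> \<le> 1 / 2" using MC(2) by simp
  have tail: "derivs_bounded k (ball 0 \<delta> - {0}) (m + int n) (2 * (M * C ^ n))
      (\<lambda>z. \<Sum>l. kernel_term a b c m\<^sub>1 P (Suc (l + n)) z)"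
  proof (rule derivs_bounded_series)
    fix l
    have "derivs_bounded k (- {0}) (m + int n + int l) (M * C ^ n * C ^ l) (kernel_term a b c m\<^sub>1 P (Suc (l + n)))"
      using MC(3)[of "l + n"] by (simp add: power_add mult_ac add_ac)
    thus "derivs_bounded k (ball 0 \<delta> - {0}) (m + int n + int l) (M * C ^ n * C ^ l) (kernel_term a b c m\<^sub>1 P (Suc (l + n)))"
      by (rule derivs_bounded_subset) auto
  qed (use MC \<delta> C\<delta> k in auto)
  have g: "g z = (\<Sum>l. kernel_term a b c m\<^sub>1 P (Suc (l + n)) z)" if "z \<in> ball 0 \<delta> - {0}" for z
  proof -
    have sums: "(\<lambda>l. kernel_term a b c m\<^sub>1 P (Suc l) z) sums K z"
      using that \<delta> by (intro assms(9)) (auto simp: punctured_disk_def)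
    have "kernel_trunc a b c m\<^sub>1 P n z = (\<Sum>l<n. kernel_term a b c m\<^sub>1 P (Suc l) z)"
      unfolding kernel_trunc_def by (rule sum.reindex_bij_witness[of _ Suc "\<lambda>l. l - 1"]) auto
    thus ?thesis
      using sums_split_initial_segment[OF sums, of n] by (simp add: g_def sums_iff)
  qed
  have flat: "Ck_on k (ball 0 \<delta>) (g(0 := 0)) \<and>
      (\<forall>is. length is \<le> k \<longrightarrow> fold partial_deriv is (g(0 := 0)) 0 = 0)"
    by (rule flat_extension[OF tail]) (use MC \<delta> k g in auto)
  \<comment> \<open>The limit in the definition of the extension is therefore 0.\<close>
  have "continuous_on (ball 0 \<delta>) (g(0 := 0))"
    using flat by (cases k) auto
  hence "\<forall>z\<in>ball 0 \<delta>. isCont (g(0 := 0)) z"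
    by (simp only: continuous_on_eq_continuous_at[OF open_ball])
  hence "isCont (g(0 := 0)) 0" by (rule bspec) (use \<delta> in simp)
  hence "((g(0 := 0)) \<longlongrightarrow> 0) (at 0)" by (simp add: isCont_def)
  hence "(g \<longlongrightarrow> 0) (at 0)"
    by (rule Lim_transform_eventually) (auto simp: eventually_at_filter)
  hence "Lim (at 0) g = 0" by (intro tendsto_Lim) auto
  hence \<rho>: "\<rho> = g(0 := 0)" by (simp add: \<rho>_def extend_at_0_def g_def[abs_def])
  have "multi_deriv \<alpha> \<rho> 0 = 0" if "int (fst \<alpha> + snd \<alpha>) \<le> m + int n - 1" for \<alpha>
  proof -
    have "length (replicate (snd \<alpha>) (2::2) @ replicate (fst \<alpha>) 1) \<le> k" using that k by simp
    thus ?thesis using flat unfolding \<rho> multi_deriv_eq_fold by blast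
  qed
  moreover have "Ck_at k \<rho> 0"
    unfolding Ck_at_def using flat \<delta> by (intro exI[of _ "ball 0 \<delta>"]) (auto simp: \<rho>)
  ultimately show ?thesis by (simp add: k_def)
qed

end
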